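(* Assume (A0), (A1), (A2) and (A3) (stated in the context) hold. Then, for any positive sequence $\alpha_n$ with $\frac1n\ll\alpha_n\ll1$ and any integer $k\ge 0$, $$\int_{\mathbb{R}^p}\big\|\sqrt{\alpha_n n}(\theta-\theta^* )\big\|_2^k\,\Big|\pi_{n,\alpha_n}(\theta|X^n)-\phi\Big(\theta\,\Big|\,\hat\theta,\tfrac{1}{\alpha_n n}V_{\theta^*}^{-1}\Big)\Big|\,d\theta\to 0\quad\text{in } f_{0,n}\text{-probability.}$$ Furthermore, suppose that for a positive, data-dependent sequence $\hat\alpha_n$ there exists a positive sequence $\alpha_n$ with $\frac1n\ll\alpha_n\ll1$ such that $\hat\alpha_n/\alpha_n\to1$ in $f_{0,n}$-probability, that $f_n(X^n|\theta)$ satisfies Conditions 1 and 2 (stated in the context), and that $\pi(\theta)\le\kappa$ for all $\theta$, for some $\kappa>0$. Then the displayed convergence holds with $\pi_{n,\alpha_n}(\theta|X^n)$ replaced by $\pi_{n,\hat\alpha_n}(\theta|X^n)$ (the other occurrences of $\alpha_n$ being unchanged).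
   Context: Setting. For each $n$, $X^n=(X_1,\dots,X_n)\in\mathcal X^n$ ($\mathcal X\subset\mathbb R^d$) is a random sample with true density $f_{0,n}$; $\mathbb P_{f_{0,n}}$ is the corresponding probability. $\{f_n(\cdot|\theta):\theta\in\Theta\subset\mathbb R^p\}$ is a parametric family of densities, possibly misspecified ($f_{0,n}$ need not belong to it). $\hat\theta=\arg\max_\theta f_n(X^n|\theta)$ is the MLE and $\pi$ is a prior density. For $\alpha>0$ the $\alpha$-posterior has density $\pi_{n,\alpha}(\theta|X^n)=f_n(X^n|\theta)^\alpha\pi(\theta)/\int_{\mathbb R^p}f_n(X^n|\theta)^\alpha\pi(\theta)\,d\theta$; the $\hat\alpha_n$-posterior is obtained by plugging in a data-dependent $\hat\alpha_n$. All these posteriors are assumed proper (finite normalizing constant). Integrands in $\theta$ are understood as zero outside $\Theta$. $\phi(\cdot|\mu,\Sigma)$ is the multivariate normal density with mean $\mu$ and covariance $\Sigma$. $a_n\ll b_n$ means $a_n/b_n\to0$. $B_v(r)$, $\bar B_v(r)$ are the open and closed Euclidean balls of radius $r$ centred at $v$. "In $f_{0,n}$-probability" means convergence in probability under $\mathbb P_{f_{0,n}}$. Assumptions; in (A2), (A3) $\alpha_n$ denotes an arbitrary positive sequence with $\frac1n\ll\alpha_n\ll1$. (A0) The MLE $\hat\theta$ is unique and there exists $\theta^*\in\Theta$, with $\Theta$ an open subset of $\mathbb R^p$, such that $\hat\theta\to\theta^*$ in $f_{0,n}$-probability and $\sqrt n(\hat\theta-\theta^* )$ is asymptotically normal. (A1)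 The prior $\pi$ is continuous and positive in an open ball around $\theta^*$. (A2) Let $\Delta_{n,\theta^*}=\sqrt n(\hat\theta-\theta^* )$. There exists a positive definite matrix $V_{\theta^*}$ such that $\sup_{h\in\bar B_0(r)}|R_n(h)|\to0$ in $f_{0,n}$-probability for any $r>0$, where $$R_n(h)=\alpha_n\Big[\log f_n\Big(X^n\Big|\theta^*+\tfrac{h}{\sqrt{\alpha_n n}}\Big)-\log f_n(X^n|\theta^* )\Big]-\sqrt{\alpha_n}\,h^\top V_{\theta^*}\Delta_{n,\theta^*}+\tfrac12h^\top V_{\theta^*}h.$$ (A3) For all $\epsilon>0$ and $k_0\ge0$ there exist a constant $M=M(k_0,\epsilon)<\infty$ and an integer $N=N(k_0,\epsilon)$ such that for $\alpha_n n\ge N$, $\mathbb P_{f_{0,n}}\big(\int_{\mathbb R^p}\|\sqrt{\alpha_n n}(\theta-\theta^* )\|_2^{k_0}\pi_{n,\alpha_n}(\theta|X^n)d\theta>M\big)<\epsilon$. Condition 1. There are constants $L,c_0,c_1>0$, $c_2\ge0$, some $r>e^{c_2/c_0}/c_1$, and a function $\gamma:[0,\infty)\to[0,\infty)$ with $\gamma(v)\ge c_0\log(1+c_1v)-c_2$ for $v\ge r$, such that with $f_{0,n}$-probability tending to one, uniformly over $\theta\in B_{\theta^*}(r)^{\mathsf c}$, $\log f_n(X^n|\theta)-\log f_n(X^n|\theta^* )\le-Ln\gamma(\|\theta-\theta^*\|_2)$. Condition 2. For the $c_0,c_1,c_2,r$ of Condition 1 there exist constants $c_3=c_3(r)>0$,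 $c_4=c_4(r)>0$ such that with $f_{0,n}$-probability tending to one, uniformly over $\theta\in B_{\hat\theta}(2r)$, $-nc_3\|\theta-\hat\theta\|_2^2\le\log f_n(X^n|\theta)-\log f_n(X^n|\hat\theta)\le-nc_4\|\theta-\hat\theta\|_2^2$. *)

theory Defs
  imports "HOL-Analysis.Analysis"
begin

section \<open>Convergence in probability\<close>

text \<open>
  Some of the quantities below are suprema over uncountable sets and need not be measurable,
  so probabilities are taken as outer measures. On measurable events these are the usual
  probabilities. The law of the data depends on the sample size: \<open>P n\<close> is the law of
  the sample of size \<open>n\<close>.
\<close>

definition tendsto_0_in_prob :: "(nat \<Rightarrow> 'a measure) \<Rightarrow> (nat \<Rightarrow> 'a \<Rightarrow> ennreal) \<Rightarrow> bool" where
  "tendsto_0_in_prob P Z \<longleftrightarrow>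
     (\<forall>\<epsilon>>0. (\<lambda>n. outer_measure_of (P n) {x \<in> space (P n). Z n x > ennreal \<epsilon>}) \<longlonglongrightarrow> 0)"

definition with_prob_tending_to_1 :: "(nat \<Rightarrow> 'a measure) \<Rightarrow> (nat \<Rightarrow> 'a \<Rightarrow> bool) \<Rightarrow> bool" where
  "with_prob_tending_to_1 P E \<longleftrightarrow>
     (\<lambda>n. outer_measure_of (P n) {x \<in> space (P n). \<not> E n x}) \<longlonglongrightarrow> 0"

section \<open>Normal distributions\<close>

text \<open>Positive definite matrices are symmetric.\<close>

definition pos_def_matrix :: "real^'p^'p \<Rightarrow> bool" where
  "pos_def_matrix V \<longleftrightarrow> transpose V = V \<and> (\<forall>v. v \<noteq> 0 \<longrightarrow> v \<bullet> (V *v v) > 0)"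

definition mvn_density :: "real^'p \<Rightarrow> real^'p^'p \<Rightarrow> real^'p \<Rightarrow> real" where
  "mvn_density \<mu> \<Sigma> \<theta> =
     exp (- ((\<theta> - \<mu>) \<bullet> (matrix_inv \<Sigma> *v (\<theta> - \<mu>))) / 2) / sqrt ((2 * pi) ^ CARD('p) * det \<Sigma>)"

text \<open>
  Convergence in distribution to a normal law, tested on bounded continuous functions. The limit is
  the law of \<open>m + A Z\<close> with \<open>Z\<close> standard normal, that is \<open>N(m, A A\<^sup>T)\<close>; its covariance matrix may
  be singular.
\<close>

definition asymptotically_normal ::
    "(nat \<Rightarrow> 'a measure) \<Rightarrow> (nat \<Rightarrow> 'a \<Rightarrow> real^'p) \<Rightarrow> bool" where
  "asymptotically_normal P Z \<longleftrightarrow>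
     (\<exists>(m :: real^'p) (A :: real^'p^'p). \<forall>g :: real^'p \<Rightarrow> real.
        continuous_on UNIV g \<and> bounded (range g) \<longrightarrow>
        (\<lambda>n. LINT x|P n. g (Z n x)) \<longlonglongrightarrow>
          (LINT z|lborel. mvn_density 0 (mat 1) z * g (m + A *v z)))"

section \<open>Data, likelihood and posterior\<close>

text \<open>
  A sample of size \<open>n\<close> is a function on \<open>{1..n}\<close>. Densities of samples are taken with respect to
  the \<open>n\<close>-fold product of a sigma-finite measure \<open>\<nu>\<close> on the sample space (Lebesgue measure, counting
  measure, etc.). They are joint densities: the observations need not be independent.
\<close>

definition sample_measure :: "'x measure \<Rightarrow> nat \<Rightarrow> (nat \<Rightarrow> 'x) measure" where
  "sample_measure \<nu> n = (\<Pi>\<^sub>M i\<in>{1..n}. \<nu>)"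

definition data_law :: "'x measure \<Rightarrow> (nat \<Rightarrow> (nat \<Rightarrow> 'x) \<Rightarrow> real) \<Rightarrow> nat \<Rightarrow> (nat \<Rightarrow> 'x) measure" where
  "data_law \<nu> f0 n = density (sample_measure \<nu> n) (\<lambda>x. ennreal (f0 n x))"

definition is_density :: "'a measure \<Rightarrow> ('a \<Rightarrow> real) \<Rightarrow> bool" where
  "is_density M g \<longleftrightarrow>
     g \<in> borel_measurable M \<and> (\<forall>x\<in>space M. g x \<ge> 0) \<and> (\<integral>\<^sup>+x. ennreal (g x) \<partial>M) = 1"

text \<open>
  Since \<open>ln 0 = 0\<close> on the reals, the log-likelihood is extended-real valued, with value \<open>-\<infinity>\<close>
  where the likelihood vanishes. As \<open>a - (-\<infinity>) = \<infinity>\<close> for every extended real \<open>a\<close>, upper bounds on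
  \<open>log_lik f n \<theta> x - log_lik f n \<theta>' x\<close> fail whenever the likelihood vanishes at \<open>\<theta>'\<close>.
\<close>

definition log_lik :: "(nat \<Rightarrow> 't \<Rightarrow> 'a \<Rightarrow> real) \<Rightarrow> nat \<Rightarrow> 't \<Rightarrow> 'a \<Rightarrow> ereal" where
  "log_lik f n \<theta> x = (if f n \<theta> x > 0 then ereal (ln (f n \<theta> x)) else - \<infinity>)"

definition posterior_kernel ::
    "(nat \<Rightarrow> real^'p \<Rightarrow> 'a \<Rightarrow> real) \<Rightarrow> (real^'p) set \<Rightarrow> (real^'p \<Rightarrow> real) \<Rightarrow>
     nat \<Rightarrow> real \<Rightarrow> 'a \<Rightarrow> real^'p \<Rightarrow> real" where
  "posterior_kernel f \<Theta> prior n a x \<theta> = indicat_real \<Theta> \<theta> * (f n \<theta> x powr a * prior \<theta>)"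

definition proper_posterior ::
    "(nat \<Rightarrow> real^'p \<Rightarrow> 'a \<Rightarrow> real) \<Rightarrow> (real^'p) set \<Rightarrow> (real^'p \<Rightarrow> real) \<Rightarrow> nat \<Rightarrow> real \<Rightarrow> 'a \<Rightarrow> bool" where
  "proper_posterior f \<Theta> prior n a x \<longleftrightarrow> integrable lborel (posterior_kernel f \<Theta> prior n a x)"

definition posterior ::
    "(nat \<Rightarrow> real^'p \<Rightarrow> 'a \<Rightarrow> real) \<Rightarrow> (real^'p) set \<Rightarrow> (real^'p \<Rightarrow> real) \<Rightarrow>
     nat \<Rightarrow> real \<Rightarrow> 'a \<Rightarrow> real^'p \<Rightarrow> real" where
  "posterior f \<Theta> prior n a x \<theta> =
     posterior_kernel f \<Theta> prior n a x \<theta> / (LINT \<theta>'|lborel. posterior_kernel f \<Theta> prior n a x \<theta>')"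

text \<open>
  Densities are only required for \<open>n \<ge> 1\<close>: the sample space of size 0 is a single point.
  The prior may be improper.
\<close>

definition parametric_model ::
    "(real^'d) set \<Rightarrow> (real^'d) measure \<Rightarrow> (nat \<Rightarrow> (nat \<Rightarrow> real^'d) \<Rightarrow> real) \<Rightarrow>
     (nat \<Rightarrow> real^'p \<Rightarrow> (nat \<Rightarrow> real^'d) \<Rightarrow> real) \<Rightarrow> (real^'p) set \<Rightarrow> (real^'p \<Rightarrow> real) \<Rightarrow> bool" where
  "parametric_model \<X> \<nu> f0 f \<Theta> prior \<longleftrightarrow>
     sigma_finite_measure \<nu> \<and> sets \<nu> = sets (restrict_space borel \<X>) \<and>
     (\<forall>n\<ge>1. is_density (sample_measure \<nu> n) (f0 n)) \<and>
     (\<forall>n\<ge>1. \<forall>\<theta>\<in>\<Theta>. is_density (sample_measure \<nu> n) (f n \<theta>)) \<and>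
     (\<forall>n\<ge>1. (\<lambda>(\<theta>, x). f n \<theta> x)
        \<in> borel_measurable (restrict_space borel \<Theta> \<Otimes>\<^sub>M sample_measure \<nu> n)) \<and>
     prior \<in> borel_measurable (restrict_space borel \<Theta>) \<and> (\<forall>\<theta>\<in>\<Theta>. prior \<theta> \<ge> 0) \<and>
     (\<forall>a>0. \<forall>n\<ge>1. AE x in data_law \<nu> f0 n. proper_posterior f \<Theta> prior n a x)"

section \<open>Assumptions\<close>

text \<open>Positive sequences with \<open>1/n \<lless> \<alpha>\<^sub>n \<lless> 1\<close>.\<close>

definition tempering_seq :: "(nat \<Rightarrow> real) \<Rightarrow> bool" where
  "tempering_seq \<alpha> \<longleftrightarrow>
     (\<forall>n\<ge>1. \<alpha> n > 0) \<and> (\<lambda>n. (1 / real n) / \<alpha> n) \<longlonglongrightarrow> 0 \<and> (\<lambda>n. \<alpha> n / 1) \<longlonglongrightarrow> 0"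

definition unique_mle ::
    "(nat \<Rightarrow> 'a measure) \<Rightarrow> (nat \<Rightarrow> 't \<Rightarrow> 'a \<Rightarrow> real) \<Rightarrow> 't set \<Rightarrow> (nat \<Rightarrow> 'a \<Rightarrow> 't) \<Rightarrow> bool" where
  "unique_mle P f \<Theta> \<theta>hat \<longleftrightarrow>
     (\<forall>n\<ge>1. AE x in P n. \<forall>\<theta>. is_arg_max (\<lambda>\<theta>. f n \<theta> x) (\<lambda>\<theta>. \<theta> \<in> \<Theta>) \<theta> \<longleftrightarrow> \<theta> = \<theta>hat n x)"

definition \<Delta>\<^sub>n :: "(nat \<Rightarrow> 'a \<Rightarrow> real^'p) \<Rightarrow> real^'p \<Rightarrow> nat \<Rightarrow> 'a \<Rightarrow> real^'p" where
  "\<Delta>\<^sub>n \<theta>hat \<theta>star n x = sqrt (real n) *\<^sub>R (\<theta>hat n x - \<theta>star)"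

definition assumption_A0 ::
    "(nat \<Rightarrow> 'a measure) \<Rightarrow> (nat \<Rightarrow> real^'p \<Rightarrow> 'a \<Rightarrow> real) \<Rightarrow> (real^'p) set \<Rightarrow>
     (nat \<Rightarrow> 'a \<Rightarrow> real^'p) \<Rightarrow> real^'p \<Rightarrow> bool" where
  "assumption_A0 P f \<Theta> \<theta>hat \<theta>star \<longleftrightarrow>
     open \<Theta> \<and> \<theta>star \<in> \<Theta> \<and>
     (\<forall>n\<ge>1. \<theta>hat n \<in> borel_measurable (P n)) \<and> unique_mle P f \<Theta> \<theta>hat \<and>
     tendsto_0_in_prob P (\<lambda>n x. ennreal (dist (\<theta>hat n x) \<theta>star)) \<and>
     asymptotically_normal P (\<Delta>\<^sub>n \<theta>hat \<theta>star)"

definition assumption_A1 :: "(real^'p \<Rightarrow> real) \<Rightarrow> real^'p \<Rightarrow> bool" where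
  "assumption_A1 prior \<theta>star \<longleftrightarrow>
     (\<exists>r>0. continuous_on (ball \<theta>star r) prior \<and> (\<forall>\<theta>\<in>ball \<theta>star r. prior \<theta> > 0))"

definition lan_remainder ::
    "(nat \<Rightarrow> real^'p \<Rightarrow> 'a \<Rightarrow> real) \<Rightarrow> (nat \<Rightarrow> 'a \<Rightarrow> real^'p) \<Rightarrow> real^'p \<Rightarrow> real^'p^'p \<Rightarrow>
     (nat \<Rightarrow> real) \<Rightarrow> nat \<Rightarrow> 'a \<Rightarrow> real^'p \<Rightarrow> ereal" where
  "lan_remainder f \<theta>hat \<theta>star V \<alpha> n x h =
     ereal (\<alpha> n) *
       (log_lik f n (\<theta>star + (1 / sqrt (\<alpha> n * real n)) *\<^sub>R h) x - log_lik f n \<theta>star x)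
     - ereal (sqrt (\<alpha> n) * (h \<bullet> (V *v \<Delta>\<^sub>n \<theta>hat \<theta>star n x)))
     + ereal (1 / 2 * (h \<bullet> (V *v h)))"

text \<open>
  The matrix \<open>V\<close> does not depend on the sequence \<open>\<alpha>\<close>. As \<open>\<Theta>\<close> is open and \<open>\<alpha>\<^sub>n n\<close> tends to infinity,
  for each \<open>r\<close> the points \<open>\<theta>star + h / sqrt (\<alpha>\<^sub>n n)\<close> with \<open>norm h \<le> r\<close> eventually lie in \<open>\<Theta>\<close>, so
  the values of \<open>f\<close> outside \<open>\<Theta>\<close> play no role.
\<close>

definition assumption_A2 ::
    "(nat \<Rightarrow> 'a measure) \<Rightarrow> (nat \<Rightarrow> real^'p \<Rightarrow> 'a \<Rightarrow> real) \<Rightarrow> (nat \<Rightarrow> 'a \<Rightarrow> real^'p) \<Rightarrow>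
     real^'p \<Rightarrow> real^'p^'p \<Rightarrow> bool" where
  "assumption_A2 P f \<theta>hat \<theta>star V \<longleftrightarrow>
     pos_def_matrix V \<and>
     (\<forall>\<alpha>. tempering_seq \<alpha> \<longrightarrow> (\<forall>r>0. tendsto_0_in_prob P
        (\<lambda>n x. SUP h\<in>cball 0 r. e2ennreal \<bar>lan_remainder f \<theta>hat \<theta>star V \<alpha> n x h\<bar>)))"

text \<open>
  The constants \<open>M\<close> and \<open>N\<close> may depend on the sequence \<open>\<alpha>\<close>.
  Moments are nonnegative Lebesgue integrals: an infinite moment counts as infinite, whereas the
  Bochner integral would return \<open>0\<close>.
\<close>

definition assumption_A3 ::
    "(nat \<Rightarrow> 'a measure) \<Rightarrow> (nat \<Rightarrow> real^'p \<Rightarrow> 'a \<Rightarrow> real) \<Rightarrow> (real^'p) set \<Rightarrow>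
     (real^'p \<Rightarrow> real) \<Rightarrow> real^'p \<Rightarrow> bool" where
  "assumption_A3 P f \<Theta> prior \<theta>star \<longleftrightarrow>
     (\<forall>\<alpha>. tempering_seq \<alpha> \<longrightarrow>
       (\<forall>\<epsilon>>0. \<forall>k0::real. k0 \<ge> 0 \<longrightarrow>
         (\<exists>(M::real) (N::nat). \<forall>n\<ge>1. \<alpha> n * real n \<ge> real N \<longrightarrow>
            outer_measure_of (P n) {x \<in> space (P n).
              (\<integral>\<^sup>+\<theta>. ennreal (norm (sqrt (\<alpha> n * real n) *\<^sub>R (\<theta> - \<theta>star)) powr k0 *
                          posterior f \<Theta> prior n (\<alpha> n) x \<theta>) \<partial>lborel) > ennreal M}
            < ennreal \<epsilon>)))"

text \<open>
  The densities exist for \<open>\<theta> \<in> \<Theta>\<close> only, so the bounds below are required on the parts of the given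
  sets inside \<open>\<Theta>\<close>.
\<close>

definition condition_1 ::
    "(nat \<Rightarrow> 'a measure) \<Rightarrow> (nat \<Rightarrow> real^'p \<Rightarrow> 'a \<Rightarrow> real) \<Rightarrow> (real^'p) set \<Rightarrow> real^'p \<Rightarrow>
     real \<Rightarrow> real \<Rightarrow> real \<Rightarrow> real \<Rightarrow> real \<Rightarrow> (real \<Rightarrow> real) \<Rightarrow> bool" where
  "condition_1 P f \<Theta> \<theta>star L c0 c1 c2 r \<gamma> \<longleftrightarrow>
     L > 0 \<and> c0 > 0 \<and> c1 > 0 \<and> c2 \<ge> 0 \<and> r > exp (c2 / c0) / c1 \<and>
     (\<forall>v\<ge>0. \<gamma> v \<ge> 0) \<and> (\<forall>v\<ge>r. \<gamma> v \<ge> c0 * ln (1 + c1 * v) - c2) \<and>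
     with_prob_tending_to_1 P (\<lambda>n x. \<forall>\<theta>\<in>\<Theta> - ball \<theta>star r.
        log_lik f n \<theta> x - log_lik f n \<theta>star x \<le> ereal (- (L * real n * \<gamma> (norm (\<theta> - \<theta>star)))))"

definition condition_2 ::
    "(nat \<Rightarrow> 'a measure) \<Rightarrow> (nat \<Rightarrow> real^'p \<Rightarrow> 'a \<Rightarrow> real) \<Rightarrow> (real^'p) set \<Rightarrow>
     (nat \<Rightarrow> 'a \<Rightarrow> real^'p) \<Rightarrow> real \<Rightarrow> bool" where
  "condition_2 P f \<Theta> \<theta>hat r \<longleftrightarrow>
     (\<exists>c3>0. \<exists>c4>0. with_prob_tending_to_1 P (\<lambda>n x. \<forall>\<theta>\<in>\<Theta> \<inter> ball (\<theta>hat n x) (2 * r).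
        ereal (- (real n * c3 * (norm (\<theta> - \<theta>hat n x))\<^sup>2))
          \<le> log_lik f n \<theta> x - log_lik f n (\<theta>hat n x) x \<and>
        log_lik f n \<theta> x - log_lik f n (\<theta>hat n x) x
          \<le> ereal (- (real n * c4 * (norm (\<theta> - \<theta>hat n x))\<^sup>2))))"

end

theory Submission
  imports Defs "HOL-Probability.Distributions"
begin

text \<open>
  Put \<open>s = sqrt (\<alpha>\<^sub>n n)\<close> and \<open>h = s (\<theta> - \<theta>star)\<close>. In this coordinate the unnormalised posterior, divided by
  its value at \<open>\<theta>star\<close>, is \<open>exp (\<alpha>\<^sub>n (log f(\<theta>) - log f(\<theta>star)))\<close> times a ratio of prior densities. The
  quadratic expansion of the log-likelihood and the continuity of the prior show that it converges to
  the Gaussian kernel \<open>exp (- h\<^sup>T V h / 2)\<close>, uniformly on balls: the linear term of the expansion involves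
  \<open>sqrt \<alpha>\<^sub>n \<Delta>\<^sub>n\<close>, which vanishes because \<open>\<Delta>\<^sub>n\<close> is tight and \<open>\<alpha>\<^sub>n\<close> tends to \<open>0\<close>. Local convergence
  together with a bounded moment of order \<open>k + 1\<close> gives convergence in the distance with weight
  \<open>norm h ^ k\<close>, also after normalisation (\<open>normalized_tendsto_gauss\<close>). The approximating normal density
  is centred at \<open>sqrt \<alpha>\<^sub>n \<Delta>\<^sub>n\<close> instead of \<open>0\<close>, but this is a vanishing translation. Its explicit
  normalising constant has to be the mass of the Gaussian kernel; this is the content of
  \<open>nn_integral_gaussian\<close>, proved by completing squares.
  
  For a data-dependent exponent the limit on balls is the same, because multiplying the exponent by a
  factor tending to \<open>1\<close> does not change the limit of a bounded log-likelihood ratio. The tails come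
  from the moment assumption at the two deterministic exponents \<open>\<alpha>\<^sub>n / 2\<close> and \<open>2 \<alpha>\<^sub>n\<close>, which are again
  tempering sequences: if \<open>a \<le> b \<le> c\<close>, then \<open>t powr b \<le> t powr a + t powr c\<close>, so the kernel at the random
  exponent is at most the sum of the kernels at these two. Assumed are moments of normalised
  posteriors, and here unnormalised ones are needed; \<open>moment_bound_from_ratio\<close> bounds the
  normalising constants.
  
  The limit theorem itself is deterministic (\<open>good_samples.posterior_tendsto_gauss\<close>). It is transferred to
  convergence in probability by contradiction: if samples on which all assumptions hold up to arbitrarily
  small tolerances could be at a distance above \<open>\<epsilon>\<close>, a sequence of them would contradict it.
\<close>

section \<open>Substitutions in Lebesgue integrals\<close>

lemma nn_integral_lborel_affine:
  fixes F :: "'a::euclidean_space \<Rightarrow> ennreal"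
  assumes [measurable]: "F \<in> borel_measurable borel" and "c \<noteq> 0"
  shows "(\<integral>\<^sup>+x. F x \<partial>lborel) = ennreal (\<bar>c\<bar> ^ DIM('a)) * (\<integral>\<^sup>+x. F (t + c *\<^sub>R x) \<partial>lborel)"
  by (subst lborel_affine[OF assms(2), of t])
     (simp add: nn_integral_density nn_integral_distr nn_integral_cmult)

lemma nn_integral_lborel_translate:
  fixes F :: "'a::euclidean_space \<Rightarrow> ennreal"
  assumes [measurable]: "F \<in> borel_measurable borel"
  shows "(\<integral>\<^sup>+x. F (x + t) \<partial>lborel) = (\<integral>\<^sup>+x. F x \<partial>lborel)"
  using nn_integral_lborel_affine[of F 1 t] by (simp add: add.commute)

text \<open>
  A shear moves each line parallel to \<open>e\<close> along itself by a translation. Spreading the integrand over a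
  second variable \<open>t\<close> with the help of a unit-mass weight \<open>w\<close> turns this into two applications of
  translation invariance: first in \<open>h\<close> by \<open>t e\<close>, then in \<open>t\<close> by \<open>g h\<close>. What remains does not
  depend on \<open>g\<close>, so the shear can be compared with \<open>g = 0\<close>.
\<close>

lemma nn_integral_lborel_shear:
  fixes F :: "'a::euclidean_space \<Rightarrow> ennreal" and g :: "'a \<Rightarrow> real"
  assumes [measurable]: "F \<in> borel_measurable borel" "g \<in> borel_measurable borel"
    and e: "e \<in> Basis" and g: "\<And>h t. g (h + t *\<^sub>R e) = g h"
  shows "(\<integral>\<^sup>+h. F (h + g h *\<^sub>R e) \<partial>lborel) = (\<integral>\<^sup>+h. F h \<partial>lborel)"
proof -
  define w :: "real \<Rightarrow> ennreal" where "w = indicator {0..1}"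
  have [measurable]: "w \<in> borel_measurable borel" by (simp add: w_def)
  have w1: "(\<integral>\<^sup>+t. w (t - a) \<partial>lborel) = 1" for a
    using nn_integral_lborel_translate[of w "-a"] by (simp add: w_def)
  have gen: "(\<integral>\<^sup>+h. F (h + k h *\<^sub>R e) \<partial>lborel) = (\<integral>\<^sup>+h. \<integral>\<^sup>+t. w (- (h \<bullet> e)) * F (h + t *\<^sub>R e) \<partial>lborel \<partial>lborel)"
    if [measurable]: "k \<in> borel_measurable borel" and k: "\<And>h t. k (h + t *\<^sub>R e) = k h" for k
  proof -
    have "(\<integral>\<^sup>+h. F (h + k h *\<^sub>R e) \<partial>lborel)
        = (\<integral>\<^sup>+h. \<integral>\<^sup>+t. w (t - h \<bullet> e) * F (h + k h *\<^sub>R e) \<partial>lborel \<partial>lborel)"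
      by (simp add: nn_integral_multc w1)
    also have "\<dots> = (\<integral>\<^sup>+t. \<integral>\<^sup>+h. w (t - h \<bullet> e) * F (h + k h *\<^sub>R e) \<partial>lborel \<partial>lborel)"
      by (rule lborel_pair.Fubini') measurable
    also have "\<dots> = (\<integral>\<^sup>+t. \<integral>\<^sup>+h. w (- (h \<bullet> e)) * F (h + (t + k h) *\<^sub>R e) \<partial>lborel \<partial>lborel)"
    proof (rule nn_integral_cong)
      fix t :: real
      show "(\<integral>\<^sup>+h. w (t - h \<bullet> e) * F (h + k h *\<^sub>R e) \<partial>lborel)
          = (\<integral>\<^sup>+h. w (- (h \<bullet> e)) * F (h + (t + k h) *\<^sub>R e) \<partial>lborel)"
        using e by (subst nn_integral_lborel_translate[of _ "t *\<^sub>R e", symmetric])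
          (auto simp: k inner_add_left algebra_simps)
    qed
    also have "\<dots> = (\<integral>\<^sup>+h. \<integral>\<^sup>+t. w (- (h \<bullet> e)) * F (h + (t + k h) *\<^sub>R e) \<partial>lborel \<partial>lborel)"
      by (rule lborel_pair.Fubini'[symmetric]) measurable
    also have "\<dots> = (\<integral>\<^sup>+h. \<integral>\<^sup>+t. w (- (h \<bullet> e)) * F (h + t *\<^sub>R e) \<partial>lborel \<partial>lborel)"
      by (rule nn_integral_cong)
         (rule nn_integral_lborel_translate[of "\<lambda>t. w (- (h \<bullet> e)) * F (h + t *\<^sub>R e)" "k h" for h], measurable)
    finally show ?thesis .
  qed
  show ?thesis
    using gen[of g] gen[of "\<lambda>_. 0"] g by simp
qed

section \<open>The Gaussian integral for a precision matrix\<close>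

lemma nn_integral_gaussian_1d:
  assumes "v > 0"
  shows "(\<integral>\<^sup>+x. ennreal (exp (- (v * x\<^sup>2 / 2))) \<partial>lborel) = ennreal (sqrt (2 * pi / v))"
proof -
  have "(\<integral>\<^sup>+x. ennreal (normal_density 0 (1 / sqrt v) x) \<partial>lborel) = 1"
    by (subst nn_integral_eq_integral) (use assms in auto)
  moreover have "exp (- (v * x\<^sup>2 / 2)) = sqrt (2 * pi / v) * normal_density 0 (1 / sqrt v) x" for x
    using assms by (simp add: normal_density_def power_divide real_sqrt_divide real_sqrt_mult field_simps)
  ultimately show ?thesis
    using assms by (simp add: ennreal_mult nn_integral_cmult)
qed

lemma matrix_entry_eq_inner: "(A :: real^'p^'p) $ i $ j = axis i 1 \<bullet> (A *v axis j 1)"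
  by (simp add: matrix_vector_mul_component inner_axis' inner_axis)

lemma quadratic_form_eq_sum:
  fixes V :: "real^'p^'p"
  shows "h \<bullet> (V *v h) = (\<Sum>i\<in>UNIV. \<Sum>j\<in>UNIV. V $ i $ j * h $ i * h $ j)"
  by (simp add: inner_vec_def matrix_vector_mult_def sum_distrib_left mult_ac)

lemma sqrt_prod: "sqrt (\<Prod>i\<in>A. f i) = (\<Prod>i\<in>A. sqrt (f i))"
  by (induction A rule: infinite_finite_induct) (auto simp: real_sqrt_mult)

lemma nn_integral_gaussian_diagonal:
  fixes V :: "real^'p^'p"
  assumes V: "pos_def_matrix V" and diag: "\<And>i j. i \<noteq> j \<Longrightarrow> V $ i $ j = 0"
  shows "(\<integral>\<^sup>+h. ennreal (exp (- (h \<bullet> (V *v h)) / 2)) \<partial>lborel) = ennreal (sqrt ((2 * pi) ^ CARD('p) / det V))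
    \<and> det V > 0"
proof -
  have pos: "V $ i $ i > 0" for i
    using V by (simp add: pos_def_matrix_def matrix_entry_eq_inner axis_eq_0_iff)
  have Bas: "(Basis :: (real^'p) set) = (\<lambda>i. axis i 1) ` UNIV"
    by (auto simp: Basis_vec_def)
  have inj: "inj (\<lambda>i::'p. axis i (1::real))" by (auto simp: inj_def axis_eq_axis)
  have q: "h \<bullet> (V *v h) = (\<Sum>i\<in>UNIV. V $ i $ i * (h $ i)\<^sup>2)" for h
  proof -
    have "(\<Sum>j\<in>UNIV. V $ i $ j * h $ i * h $ j) = V $ i $ i * (h $ i)\<^sup>2" for i
      by (subst sum.remove[of _ i]) (auto simp: diag power2_eq_square intro!: sum.neutral)
    then show ?thesis by (simp add: quadratic_form_eq_sum)
  qed
  define f where "f = (\<lambda>(b::real^'p) x. exp (- ((b \<bullet> (V *v b)) * x\<^sup>2) / 2))"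
  have "exp (- (h \<bullet> (V *v h)) / 2) = (\<Prod>b\<in>Basis. f b (h \<bullet> b))" for h
    unfolding q by (simp add: Bas prod.reindex[OF inj] f_def flip: matrix_entry_eq_inner)
       (simp add: inner_axis exp_sum[symmetric] sum_negf sum_divide_distrib)
  then have "(\<integral>\<^sup>+h. ennreal (exp (- (h \<bullet> (V *v h)) / 2)) \<partial>lborel) = (\<integral>\<^sup>+h. (\<Prod>b\<in>Basis. ennreal (f b (h \<bullet> b))) \<partial>lborel)"
    by (simp add: prod_ennreal f_def)
  also have "\<dots> = (\<Prod>b\<in>Basis. (\<integral>\<^sup>+x. f b x \<partial>lborel))"
    by (rule nn_integral_lborel_prod) (auto simp: f_def)
  also have "\<dots> = (\<Prod>i\<in>UNIV. ennreal (sqrt (2 * pi / V $ i $ i)))"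
    using pos by (simp add: Bas prod.reindex[OF inj] f_def nn_integral_gaussian_1d flip: matrix_entry_eq_inner)
  also have "\<dots> = ennreal (sqrt (\<Prod>i\<in>UNIV. 2 * pi / V $ i $ i))"
    using pos by (simp add: prod_ennreal sqrt_prod less_imp_le)
  also have "(\<Prod>i\<in>UNIV. 2 * pi / V $ i $ i) = (2 * pi) ^ CARD('p) / det V"
    by (simp add: prod_dividef det_diagonal[OF diag])
  finally show ?thesis
    using pos by (auto simp: det_diagonal[OF diag] intro!: prod_pos)
qed

lemma matrix_transpose_congruence:
  fixes E W :: "real^'p^'p"
  shows "v \<bullet> ((transpose E ** W ** E) *v v) = (E *v v) \<bullet> (W *v (E *v v))"
proof -
  have "v \<bullet> (transpose E *v u) = (E *v v) \<bullet> u" for u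
    using dot_lmul_matrix[of u E v] by (simp add: transpose_matrix_vector inner_commute)
  then show ?thesis
    by (simp add: matrix_vector_mul_assoc[symmetric])
qed

text \<open>
  The Gaussian integral, by completing squares one coordinate at a time. The set \<open>S\<close> contains the
  coordinates that are still coupled. For \<open>a \<in> S\<close>, completing the square in the coordinate \<open>a\<close> reads
  \<open>V = E\<^sup>T W E\<close>, where \<open>E\<close> is a shear in the direction of \<open>a\<close> and \<open>W\<close> is the Schur complement of
  the entry \<open>(a, a)\<close> next to this entry. The shear changes neither Lebesgue measure nor the
  determinant, and \<open>W\<close> is coupled only within \<open>S - {a}\<close>.
\<close>

lemma nn_integral_gaussian_block:
  fixes V :: "real^'p^'p"
  assumes "finite S" "pos_def_matrix V" "\<And>i j. i \<noteq> j \<Longrightarrow> \<not> (i \<in> S \<and> j \<in> S) \<Longrightarrow> V $ i $ j = 0"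
  shows "(\<integral>\<^sup>+h. ennreal (exp (- (h \<bullet> (V *v h)) / 2)) \<partial>lborel) = ennreal (sqrt ((2 * pi) ^ CARD('p) / det V))
    \<and> det V > 0"
  using assms
proof (induction S arbitrary: V rule: finite_induct)
  case empty
  then show ?case by (intro nn_integral_gaussian_diagonal) auto
next
  case (insert a S)
  note V = insert.prems(1) and zero = insert.prems(2)
  define p where "p = V $ a $ a"
  have p: "p > 0"
    using V by (simp add: p_def pos_def_matrix_def matrix_entry_eq_inner axis_eq_0_iff)
  have sym: "V $ i $ j = V $ j $ i" for i j
  proof -
    have "transpose V $ i $ j = V $ i $ j" using V by (simp add: pos_def_matrix_def)
    then show ?thesis by (simp add: transpose_def)
  qed
  define E :: "real^'p^'p" where "E = (\<chi> i j. if i = a then V $ a $ j / p else if i = j then 1 else 0)"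
  define W :: "real^'p^'p" where
    "W = (\<chi> i j. if i = a \<or> j = a then (if i = j then p else 0) else V $ i $ j - V $ i $ a * V $ a $ j / p)"
  have WE: "(W ** E) $ i $ j = (if i = a then V $ a $ j else W $ i $ j)" for i j
  proof (cases "i = a")
    case True
    have "(\<Sum>k\<in>UNIV. W $ a $ k * E $ k $ j) = (\<Sum>k\<in>UNIV. if k = a then V $ a $ j else 0)"
      using p by (intro sum.cong) (auto simp: W_def E_def)
    then show ?thesis using True by (simp add: matrix_matrix_mult_def)
  next
    case False
    have "(\<Sum>k\<in>UNIV. W $ i $ k * E $ k $ j) = (\<Sum>k\<in>UNIV. if k = j then W $ i $ j else 0)"
      using False by (intro sum.cong) (auto simp: W_def E_def)
    then show ?thesis using False by (simp add: matrix_matrix_mult_def)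
  qed
  have cong: "transpose E ** W ** E = V"
  proof -
    have "(transpose E ** (W ** E)) $ i $ j = V $ i $ j" for i j
    proof -
      have "(transpose E ** (W ** E)) $ i $ j = (\<Sum>k\<in>UNIV. E $ k $ i * (W ** E) $ k $ j)"
        by (simp add: matrix_matrix_mult_def transpose_def)
      also have "\<dots> = E $ a $ i * V $ a $ j + (\<Sum>k\<in>UNIV - {a}. if k = i then W $ i $ j else 0)"
      proof -
        have "(\<Sum>k\<in>UNIV - {a}. E $ k $ i * (W ** E) $ k $ j) = (\<Sum>k\<in>UNIV - {a}. if k = i then W $ i $ j else 0)"
          by (intro sum.cong refl) (auto simp: WE, auto simp: E_def)
        then show ?thesis by (subst sum.remove[of _ a]) (auto simp: WE)
      qed
      also have "\<dots> = V $ i $ j"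
        using p sym[of i a] by (auto simp: E_def W_def p_def cong: if_cong)
      finally show ?thesis .
    qed
    then show ?thesis by (simp add: vec_eq_iff matrix_mul_assoc)
  qed
  have detE: "det E = 1"
  proof -
    have "E = (\<chi> k. if k = a then row a (mat 1) + (\<Sum>j\<in>UNIV - {a}. (V $ a $ j / p) *\<^sub>R row j (mat 1)) else row k (mat 1))"
    proof -
      have "(\<Sum>x\<in>UNIV - {a}. V $ a $ x * (if x = j then 1 else 0) / p) = (if j = a then 0 else V $ a $ j / p)" for j
        by (subst sum.mono_neutral_cong_right[of _ "{j} - {a}"]) auto
      then show ?thesis
        using p by (auto simp: vec_eq_iff E_def row_def mat_def p_def)
    qed
    also have "det \<dots> = det (mat 1 :: real^'p^'p)"
      unfolding scalar_mult_eq_scaleR[symmetric]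
      by (intro det_row_span vec.span_sum vec.span_scale vec.span_base) auto
    finally show ?thesis by simp
  qed
  \<comment> \<open>Positive definiteness passes to \<open>W\<close> because \<open>E\<close> is onto.\<close>
  obtain E' where E': "E ** E' = mat 1"
    using detE invertible_det_nz[of E] by (auto simp: invertible_def)
  have W: "pos_def_matrix W"
    unfolding pos_def_matrix_def
  proof (intro conjI allI impI)
    have "W $ j $ i = W $ i $ j" for i j
      using sym[of i j] sym[of i a] sym[of j a] by (simp add: W_def)
    then show "transpose W = W"
      by (simp add: transpose_def vec_eq_iff)
    fix w :: "real^'p" assume "w \<noteq> 0"
    have w: "E *v (E' *v w) = w" using E' by (simp add: matrix_vector_mul_assoc)
    with \<open>w \<noteq> 0\<close> have "E' *v w \<noteq> 0" by auto
    then have "0 < (E' *v w) \<bullet> (V *v (E' *v w))" using V by (simp add: pos_def_matrix_def)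
    then show "0 < w \<bullet> (W *v w)"
      unfolding cong[symmetric] matrix_transpose_congruence w .
  qed
  have W0: "W $ i $ j = 0" if "i \<noteq> j" "\<not> (i \<in> S \<and> j \<in> S)" for i j
  proof (cases "i = a \<or> j = a")
    case False
    then have "V $ i $ j = 0" "V $ i $ a = 0 \<or> V $ a $ j = 0"
      using that zero[of i j] zero[of i a] zero[of a j] by auto
    with False show ?thesis by (auto simp: W_def)
  qed (use that in \<open>auto simp: W_def\<close>)
  have IH: "(\<integral>\<^sup>+h. ennreal (exp (- (h \<bullet> (W *v h)) / 2)) \<partial>lborel) = ennreal (sqrt ((2 * pi) ^ CARD('p) / det W))"
     "det W > 0"
    using insert.IH[OF W W0] by auto
  have "det W = det V"
    by (simp add: cong[symmetric] det_mul detE)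
  define g where "g = (\<lambda>h::real^'p. \<Sum>j\<in>UNIV - {a}. V $ a $ j / p * h $ j)"
  have [measurable]: "g \<in> borel_measurable borel"
    unfolding g_def by measurable
  have Eg: "E *v h = h + g h *\<^sub>R axis a 1" for h
  proof -
    have "(\<Sum>j\<in>UNIV. E $ i $ j * h $ j) = h $ i + g h * axis a 1 $ i" for i
    proof (cases "i = a")
      case True
      then show ?thesis
        using p by (subst sum.remove[of _ a]) (auto simp: E_def g_def p_def)
    next
      case False
      then show ?thesis
        by (simp add: E_def axis_def if_distrib[of "\<lambda>x. x * _"] cong: if_cong)
    qed
    then show ?thesis by (simp add: vec_eq_iff matrix_vector_mult_def)
  qed
  have "(\<integral>\<^sup>+h. ennreal (exp (- (h \<bullet> (V *v h)) / 2)) \<partial>lborel)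
      = (\<integral>\<^sup>+h. ennreal (exp (- ((h + g h *\<^sub>R axis a 1) \<bullet> (W *v (h + g h *\<^sub>R axis a 1))) / 2)) \<partial>lborel)"
    unfolding cong[symmetric] matrix_transpose_congruence Eg ..
  also have "\<dots> = (\<integral>\<^sup>+h. ennreal (exp (- (h \<bullet> (W *v h)) / 2)) \<partial>lborel)"
    by (rule nn_integral_lborel_shear[of "\<lambda>h. ennreal (exp (- (h \<bullet> (W *v h)) / 2))"])
       (auto simp: g_def axis_def Basis_vec_def intro!: sum.cong borel_measurable_continuous_onI
          continuous_intros matrix_vector_mult_linear_continuous_on)
  finally show ?case using IH \<open>det W = det V\<close> by simp
qed

lemma nn_integral_gaussian:
  fixes V :: "real^'p^'p"
  assumes "pos_def_matrix V"
  shows "(\<integral>\<^sup>+h. ennreal (exp (- (h \<bullet> (V *v h)) / 2)) \<partial>lborel) = ennreal (sqrt ((2 * pi) ^ CARD('p) / det V))"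
    and "det V > 0"
  using nn_integral_gaussian_block[of UNIV V] assms by auto

section \<open>Gaussian kernels and the normal density\<close>

text \<open>
  \<open>V\<close> is the precision matrix: up to its total mass this is the density of \<open>N(0, V\<^sup>-\<^sup>1)\<close>.
\<close>

definition gauss_kernel :: "real^'p^'p \<Rightarrow> real^'p \<Rightarrow> real" where
  "gauss_kernel V h = exp (- (h \<bullet> (V *v h)) / 2)"

lemma continuous_gauss_kernel [continuous_intros]: "continuous_on S (gauss_kernel V)"
  unfolding gauss_kernel_def
  by (intro continuous_intros matrix_vector_mult_linear_continuous_on) auto

lemma borel_measurable_gauss_kernel [measurable]: "gauss_kernel V \<in> borel_measurable borel"
  by (intro borel_measurable_continuous_onI continuous_intros)

lemma gauss_kernel_pos: "gauss_kernel V h > 0"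
  by (simp add: gauss_kernel_def)

lemma gauss_kernel_le_1: "pos_def_matrix V \<Longrightarrow> gauss_kernel V h \<le> 1"
  by (cases "h = 0") (auto simp: gauss_kernel_def pos_def_matrix_def less_imp_le)

text \<open>
  The minimum of the quadratic form over the compact unit sphere is attained, hence positive.
\<close>

lemma pos_def_coercive:
  fixes V :: "real^'p^'p"
  assumes V: "pos_def_matrix V"
  obtains c where "c > 0" "\<And>h. h \<bullet> (V *v h) \<ge> c * (norm h)\<^sup>2"
proof -
  have "continuous_on (sphere 0 1) (\<lambda>h. h \<bullet> (V *v h))"
    by (intro continuous_intros matrix_vector_mult_linear_continuous_on)
  moreover have "sphere 0 1 \<noteq> ({} :: (real^'p) set)" by simp
  ultimately obtain u where u: "u \<in> sphere 0 1" "\<And>h. h \<in> sphere 0 1 \<Longrightarrow> u \<bullet> (V *v u) \<le> h \<bullet> (V *v h)"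
    using continuous_attains_inf[of "sphere (0 :: real^'p) 1" "\<lambda>h. h \<bullet> (V *v h)"] by auto
  have "u \<noteq> 0" using u(1) by auto
  show thesis
  proof
    show "u \<bullet> (V *v u) > 0" using V \<open>u \<noteq> 0\<close> by (simp add: pos_def_matrix_def)
    fix h :: "real^'p"
    show "h \<bullet> (V *v h) \<ge> u \<bullet> (V *v u) * (norm h)\<^sup>2"
    proof (cases "h = 0")
      case False
      then have "u \<bullet> (V *v u) \<le> (h /\<^sub>R norm h) \<bullet> (V *v (h /\<^sub>R norm h))"
        by (intro u(2)) simp
      also have "\<dots> = (h \<bullet> (V *v h)) / (norm h)\<^sup>2"
        by (simp add: matrix_vector_mult_scaleR power2_eq_square field_simps)
      finally show ?thesis using False by (simp add: field_simps)
    qed simp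
  qed
qed

lemma power_times_exp_bound:
  fixes t b :: real
  assumes "t \<ge> 0" "b > 0"
  shows "t ^ k * exp (- (b * t\<^sup>2)) \<le> 1 + fact k / b ^ k"
proof -
  define x where "x = b * t\<^sup>2"
  have x: "x \<ge> 0" using assms by (simp add: x_def)
  have "x ^ k / fact k \<le> exp x"
    using sum_le_suminf[OF summable_exp[of x], of "{k}"] x
    by (simp add: exp_def scaleR_conv_of_real divide_inverse mult_ac zero_le_power)
  then have xk: "x ^ k \<le> fact k * exp x" by (simp add: field_simps)
  have "t ^ k \<le> 1 + (t\<^sup>2) ^ k"
  proof (cases "t \<le> 1")
    case True
    then show ?thesis using assms by (simp add: power_le_one add_increasing2)
  next
    case False
    then have "t ^ k \<le> t ^ (2 * k)" by (intro power_increasing) auto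
    then show ?thesis by (simp add: power_mult)
  qed
  also have "(t\<^sup>2) ^ k = x ^ k / b ^ k" using assms by (simp add: x_def power_mult_distrib)
  also have "\<dots> \<le> fact k * exp x / b ^ k" using assms xk by (intro divide_right_mono) auto
  finally have "t ^ k * exp (- x) \<le> (1 + fact k * exp x / b ^ k) * exp (- x)"
    by (intro mult_right_mono) auto
  also have "\<dots> = exp (- x) + fact k / b ^ k"
    by (simp add: distrib_right exp_minus field_simps)
  also have "\<dots> \<le> 1 + fact k / b ^ k" using x by simp
  finally show ?thesis by (simp add: x_def)
qed

lemma mat_mult_vector: "mat c *v (v :: real^'p) = c *\<^sub>R v"
  by (simp add: vec_eq_iff matrix_vector_mult_def mat_def if_distrib[of "\<lambda>x. x * _"] cong: if_cong)

lemma pos_def_mat: "c > 0 \<Longrightarrow> pos_def_matrix (mat c :: real^'p^'p)"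
  by (simp add: pos_def_matrix_def transpose_mat mat_mult_vector)

lemma gauss_kernel_moment_finite:
  assumes V: "pos_def_matrix V"
  shows "(\<integral>\<^sup>+h. ennreal (norm h ^ k * gauss_kernel V h) \<partial>lborel) < \<infinity>"
proof -
  obtain c where c: "c > 0" "\<And>h. h \<bullet> (V *v h) \<ge> c * (norm h)\<^sup>2"
    using pos_def_coercive[OF V] by blast
  define K where "K = 1 + fact k / (c / 4) ^ k"
  have K: "K \<ge> 0" using c by (simp add: K_def)
  define W where "W = (mat (c / 2) :: real^'a^'a)"
  have W: "pos_def_matrix W" using c by (simp add: W_def pos_def_mat)
  have Wk: "gauss_kernel W h = exp (- (c / 4 * (norm h)\<^sup>2))" for h
    by (simp add: gauss_kernel_def W_def mat_mult_vector power2_norm_eq_inner)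
  \<comment> \<open>Half of the coercive decay pays for the polynomial factor, the other half is the Gaussian \<open>W\<close>.\<close>
  have "norm h ^ k * gauss_kernel V h \<le> K * gauss_kernel W h" for h
  proof -
    have "norm h ^ k * gauss_kernel V h \<le> norm h ^ k * exp (- (c * (norm h)\<^sup>2 / 2))"
      using c(2)[of h] by (intro mult_left_mono) (auto simp: gauss_kernel_def)
    also have "\<dots> = norm h ^ k * exp (- (c / 4 * (norm h)\<^sup>2)) * gauss_kernel W h"
      by (simp add: Wk mult.assoc exp_add[symmetric])
    also have "\<dots> \<le> K * gauss_kernel W h"
      using power_times_exp_bound[of "norm h" "c / 4" k] c
      by (intro mult_right_mono) (auto simp: K_def gauss_kernel_pos less_imp_le)
    finally show ?thesis .
  qed
  then have "(\<integral>\<^sup>+h. ennreal (norm h ^ k * gauss_kernel V h) \<partial>lborel) \<le> (\<integral>\<^sup>+h. ennreal (K * gauss_kernel W h) \<partial>lborel)"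
    by (intro nn_integral_mono ennreal_leI)
  also have "\<dots> = ennreal K * (\<integral>\<^sup>+h. ennreal (gauss_kernel W h) \<partial>lborel)"
    using K by (simp add: ennreal_mult gauss_kernel_pos less_imp_le nn_integral_cmult)
  also have "\<dots> < \<infinity>"
    using nn_integral_gaussian[OF W] by (simp add: gauss_kernel_def ennreal_mult_less_top)
  finally show ?thesis .
qed

lemma integrable_gauss_kernel: "pos_def_matrix V \<Longrightarrow> integrable lborel (gauss_kernel V)"
  using gauss_kernel_moment_finite[of V 0]
  by (intro integrableI_nonneg) (auto simp: gauss_kernel_pos less_imp_le)

lemma integral_gauss_kernel:
  fixes V :: "real^'p^'p"
  assumes "pos_def_matrix V"
  shows "integral\<^sup>L lborel (gauss_kernel V) = sqrt ((2 * pi) ^ CARD('p) / det V)"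
    and "integral\<^sup>L lborel (gauss_kernel V) > 0"
proof -
  show *: "integral\<^sup>L lborel (gauss_kernel V) = sqrt ((2 * pi) ^ CARD('p) / det V)"
    using nn_integral_gaussian[OF assms]
    by (intro integral_eq_nn_integral[THEN trans])
       (auto simp: gauss_kernel_pos less_imp_le, simp add: gauss_kernel_def)
  show "integral\<^sup>L lborel (gauss_kernel V) > 0"
    unfolding * using nn_integral_gaussian(2)[OF assms] by simp
qed

lemma matrix_inv_eqI:
  fixes A :: "real^'p^'p"
  assumes "A ** B = mat 1" "B ** A = mat 1"
  shows "matrix_inv A = B"
proof -
  have "A ** matrix_inv A = mat 1 \<and> matrix_inv A ** A = mat 1"
    unfolding matrix_inv_def by (rule someI[where x = B]) (use assms in simp)
  then show ?thesis
    by (metis assms(2) matrix_mul_assoc matrix_mul_lid matrix_mul_rid)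
qed

lemma det_scaleR: "det (c *\<^sub>R (A :: real^'p^'p)) = c ^ CARD('p) * det A"
proof -
  have "c *\<^sub>R A = mat c ** A"
    by (simp add: vec_eq_iff matrix_matrix_mult_def mat_def if_distrib[of "\<lambda>x. x * _"] cong: if_cong)
  then show ?thesis
    by (simp add: det_mul flip: matrix_scaleR)
qed

text \<open>
  In the coordinate \<open>h = s (\<theta>' - \<theta>)\<close> the approximating normal density becomes a Gaussian with
  a precision matrix free of \<open>s\<close>, centred at the rescaled deviation of the mean. The factor
  \<open>s ^ CARD('p)\<close> is the Jacobian of the change of coordinate.
\<close>

lemma mvn_density_local_coordinates:
  fixes V :: "real^'p^'p"
  assumes V: "pos_def_matrix V" and s: "s > 0"
  shows "mvn_density \<mu> ((1 / s\<^sup>2) *\<^sub>R matrix_inv V) (\<theta> + (1 / s) *\<^sub>R h)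
    = s ^ CARD('p) * (gauss_kernel V (h - s *\<^sub>R (\<mu> - \<theta>)) / integral\<^sup>L lborel (gauss_kernel V))"
proof -
  have det: "det V > 0" by (rule nn_integral_gaussian(2)[OF V])
  then obtain B where B: "V ** B = mat 1" "B ** V = mat 1"
    using invertible_det_nz[of V] by (auto simp: invertible_def)
  have iV: "matrix_inv V = B" by (rule matrix_inv_eqI[OF B])
  have inv: "matrix_inv ((1 / s\<^sup>2) *\<^sub>R B) = s\<^sup>2 *\<^sub>R V"
    using s B by (intro matrix_inv_eqI) (simp_all add: matrix_scalar_ac scalar_matrix_assoc[symmetric])
  have "det V * det B = 1" using B by (metis det_I det_mul)
  then have dB: "det B = 1 / det V" using det by (simp add: field_simps)
  define x where "x = h - s *\<^sub>R (\<mu> - \<theta>)"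
  have x: "\<theta> + (1 / s) *\<^sub>R h - \<mu> = (1 / s) *\<^sub>R x"
    using s by (simp add: x_def algebra_simps)
  have e: "(1 / s) *\<^sub>R x \<bullet> ((s\<^sup>2 *\<^sub>R V) *v ((1 / s) *\<^sub>R x)) = x \<bullet> (V *v x)"
    unfolding scaleR_matrix_vector_assoc[symmetric] matrix_vector_mult_scaleR using s by (simp add: power2_eq_square)
  have s2: "(1 / s\<^sup>2) ^ CARD('p) = (1 / s ^ CARD('p))\<^sup>2"
    by (simp add: power_divide power2_eq_square power_mult_distrib)
  have "sqrt ((2 * pi) ^ CARD('p) * ((1 / s\<^sup>2) ^ CARD('p) * (1 / det V)))
      = sqrt ((2 * pi) ^ CARD('p) / det V) * (1 / s ^ CARD('p))"
    unfolding s2 using s by (simp add: real_sqrt_mult real_sqrt_divide)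
  then show ?thesis
    unfolding mvn_density_def iV inv x e det_scaleR dB integral_gauss_kernel(1)[OF V]
    by (simp add: gauss_kernel_def x_def)
qed

section \<open>Weighted L1 convergence to a Gaussian\<close>

lemma ennreal_mult_add:
  "0 \<le> c \<Longrightarrow> 0 \<le> x \<Longrightarrow> 0 \<le> y \<Longrightarrow> ennreal (c * (x + y)) = ennreal c * (ennreal x + ennreal y)"
  by (simp add: ennreal_mult)

text \<open>
  Pointwise convergence with local bounds gives convergence in \<open>L\<^sup>1\<close> on balls. Outside the ball of
  radius \<open>r \<ge> 1\<close> the weight \<open>norm h ^ m\<close> is at most \<open>norm h ^ Suc k / r\<close>, so one bounded moment of
  order \<open>Suc k\<close> makes the tails uniformly small.
\<close>

lemma tendsto_0_weighted_L1:
  fixes G :: "nat \<Rightarrow> 'a::euclidean_space \<Rightarrow> real" and g :: "'a \<Rightarrow> real"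
  assumes [measurable]: "\<And>j. G j \<in> borel_measurable borel" "g \<in> borel_measurable borel"
    and nonneg: "\<And>j h. G j h \<ge> 0" "\<And>h. g h \<ge> 0"
    and ptw: "\<And>h. (\<lambda>j. G j h) \<longlonglongrightarrow> g h"
    and bdd: "\<And>r. \<exists>B. \<forall>\<^sub>F j in sequentially. \<forall>h\<in>cball 0 r. G j h \<le> B"
    and mom: "\<forall>\<^sub>F j in sequentially. (\<integral>\<^sup>+h. ennreal (norm h ^ Suc k * G j h) \<partial>lborel) \<le> K" "K < \<infinity>"
    and gmom: "(\<integral>\<^sup>+h. ennreal (norm h ^ Suc k * g h) \<partial>lborel) < \<infinity>"
    and "m \<le> k"
  shows "(\<lambda>j. \<integral>\<^sup>+h. ennreal (norm h ^ m * \<bar>G j h - g h\<bar>) \<partial>lborel) \<longlonglongrightarrow> 0"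
proof (rule tendsto_zero_ennreal)
  fix e :: real assume e: "0 < e"
  define Kg where "Kg = (\<integral>\<^sup>+h. ennreal (norm h ^ Suc k * g h) \<partial>lborel)"
  obtain K' where K': "K' \<ge> 0" "K + Kg = ennreal K'"
    using mom(2) gmom by (cases "K + Kg") (auto simp: Kg_def less_top)
  \<comment> \<open>With this radius the tail contributes at most \<open>K' / r \<le> e / 4\<close>.\<close>
  define r where "r = max 1 (4 * K' / e)"
  have r: "r \<ge> 1" and rK: "K' / r \<le> e / 4"
    using e K' by (auto simp: r_def field_simps max_def)
  have [measurable]: "cball (0::'a) r \<in> sets borel" by simp
  define u where "u = (\<lambda>j h. ennreal (indicator (cball 0 r) h * (norm h ^ m * \<bar>G j h - g h\<bar>)))"
  obtain B where B: "\<forall>\<^sub>F j in sequentially. \<forall>h\<in>cball 0 r. G j h \<le> B"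
    using bdd by blast
  then obtain N where N: "\<And>j h. j \<ge> N \<Longrightarrow> h \<in> cball 0 r \<Longrightarrow> G j h \<le> B"
    unfolding eventually_sequentially by blast
  have gB: "g h \<le> B" if "h \<in> cball 0 r" for h
    using N[OF _ that] by (intro LIMSEQ_le_const2[OF ptw]) blast
  have "B \<ge> 0" using gB[of 0] nonneg(2)[of 0] r by simp
  \<comment> \<open>The local bound holds from \<open>N\<close> on only, and dominated convergence needs it for every index.\<close>
  have "(\<lambda>j. \<integral>\<^sup>+h. u (j + N) h \<partial>lborel) \<longlonglongrightarrow> (\<integral>\<^sup>+h. 0 \<partial>(lborel :: 'a measure))"
  proof (rule nn_integral_dominated_convergence[where w = "\<lambda>h. ennreal (r ^ m * B) * indicator (cball 0 r) h"])
    show "AE h in lborel. u (j + N) h \<le> ennreal (r ^ m * B) * indicator (cball 0 r) h" for j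
    proof (rule AE_I2)
      fix h :: 'a
      show "u (j + N) h \<le> ennreal (r ^ m * B) * indicator (cball 0 r) h"
      proof (cases "h \<in> cball 0 r")
        case True
        have "\<bar>G (j + N) h - g h\<bar> \<le> B"
          using N[of "j + N" h] gB[of h] True nonneg(1)[of "j + N" h] nonneg(2)[of h] by auto
        then have "norm h ^ m * \<bar>G (j + N) h - g h\<bar> \<le> r ^ m * B"
          using True r by (intro mult_mono power_mono) auto
        then show ?thesis using True by (simp add: u_def ennreal_leI)
      qed (simp add: u_def)
    qed
    have "emeasure lborel (cball (0::'a) r) < \<infinity>"
      by (intro emeasure_bounded_finite) simp
    then show "(\<integral>\<^sup>+h. ennreal (r ^ m * B) * indicator (cball (0::'a) r) h \<partial>lborel) < \<infinity>"
      by (simp add: nn_integral_cmult_indicator ennreal_mult_less_top)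
    show "AE h in lborel. (\<lambda>j. u (j + N) h) \<longlonglongrightarrow> 0"
    proof (rule AE_I2)
      fix h
      have "(\<lambda>j. indicator (cball 0 r) h * (norm h ^ m * \<bar>G j h - g h\<bar>)) \<longlonglongrightarrow>
            indicator (cball 0 r) h * (norm h ^ m * \<bar>g h - g h\<bar>)"
        by (intro tendsto_intros ptw)
      then have "(\<lambda>j. u j h) \<longlonglongrightarrow> ennreal 0"
        unfolding u_def by (intro tendsto_ennrealI) simp
      then show "(\<lambda>j. u (j + N) h) \<longlonglongrightarrow> 0"
        using LIMSEQ_ignore_initial_segment by force
    qed
  qed (simp_all add: u_def)
  then have "(\<lambda>j. \<integral>\<^sup>+h. u j h \<partial>lborel) \<longlonglongrightarrow> 0"
    using LIMSEQ_offset[of "\<lambda>j. \<integral>\<^sup>+h. u j h \<partial>lborel" N 0] by simp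
  then have small: "\<forall>\<^sub>F j in sequentially. (\<integral>\<^sup>+h. u j h \<partial>lborel) < ennreal (e / 2)"
    using e by (intro order_tendstoD) auto
  show "\<forall>\<^sub>F j in sequentially. (\<integral>\<^sup>+h. ennreal (norm h ^ m * \<bar>G j h - g h\<bar>) \<partial>lborel) < ennreal e"
    using small mom(1)
  proof eventually_elim
    case (elim j)
    have "ennreal (norm h ^ m * \<bar>G j h - g h\<bar>)
        \<le> u j h + ennreal (1 / r) * (ennreal (norm h ^ Suc k * G j h) + ennreal (norm h ^ Suc k * g h))" for h
    proof (cases "h \<in> cball 0 r")
      case True
      then show ?thesis by (simp add: u_def add_increasing2)
    next
      case False
      then have h: "norm h > r" by simp
      have "norm h ^ m \<le> norm h ^ k" using h r \<open>m \<le> k\<close> by (intro power_increasing) auto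
      also have "\<dots> \<le> (1 / r) * norm h ^ Suc k"
        using h r by (simp add: field_simps mult_right_mono)
      finally have "norm h ^ m * \<bar>G j h - g h\<bar> \<le> (1 / r) * norm h ^ Suc k * (G j h + g h)"
        using nonneg(1)[of j h] nonneg(2)[of h] h r by (intro mult_mono) auto
      also have "\<dots> = (1 / r) * (norm h ^ Suc k * G j h + norm h ^ Suc k * g h)"
        by (simp only: distrib_left mult.assoc)
      finally have "ennreal (norm h ^ m * \<bar>G j h - g h\<bar>)
          \<le> ennreal ((1 / r) * (norm h ^ Suc k * G j h + norm h ^ Suc k * g h))"
        by (rule ennreal_leI)
      also have "\<dots> = ennreal (1 / r) * (ennreal (norm h ^ Suc k * G j h) + ennreal (norm h ^ Suc k * g h))"
        using r nonneg by (intro ennreal_mult_add) auto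
      finally show ?thesis by (simp add: add_increasing)
    qed
    then have "(\<integral>\<^sup>+h. ennreal (norm h ^ m * \<bar>G j h - g h\<bar>) \<partial>lborel)
        \<le> (\<integral>\<^sup>+h. u j h + ennreal (1 / r) * (ennreal (norm h ^ Suc k * G j h) + ennreal (norm h ^ Suc k * g h)) \<partial>lborel)"
      by (rule nn_integral_mono)
    also have "\<dots> = (\<integral>\<^sup>+h. u j h \<partial>lborel) + ennreal (1 / r) *
        ((\<integral>\<^sup>+h. ennreal (norm h ^ Suc k * G j h) \<partial>lborel) + Kg)"
      unfolding Kg_def u_def by (subst nn_integral_add nn_integral_cmult; (measurable)?)+
    also have "\<dots> \<le> ennreal (e / 2) + ennreal (1 / r) * (K + Kg)"
      using elim by (auto intro!: add_mono mult_left_mono)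
    also have "\<dots> = ennreal (e / 2 + K' / r)"
      using K' r e by (simp add: ennreal_mult[symmetric] ennreal_plus[symmetric] del: ennreal_plus)
    also have "\<dots> < ennreal e"
      by (intro ennreal_lessI) (use rK e in linarith)+
    finally show ?case .
  qed
qed

text \<open>
  Continuity of translations in the weighted \<open>L\<^sup>1\<close> distance: it lets the Gaussian limit be centred at
  the rescaled maximum likelihood estimator, or equally well at \<open>0\<close>.
\<close>

lemma gauss_kernel_translate_tendsto:
  fixes V :: "real^'p^'p"
  assumes V: "pos_def_matrix V" and d: "d \<longlonglongrightarrow> 0"
  shows "(\<lambda>j. \<integral>\<^sup>+h. ennreal (norm h ^ k * \<bar>gauss_kernel V (h - d j) - gauss_kernel V h\<bar>) \<partial>lborel) \<longlonglongrightarrow> 0"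
proof (rule tendsto_0_weighted_L1)
  define K where "K = ennreal (2 ^ Suc k) * ((\<integral>\<^sup>+h. ennreal (norm h ^ Suc k * gauss_kernel V h) \<partial>lborel)
      + (\<integral>\<^sup>+h. ennreal (norm h ^ 0 * gauss_kernel V h) \<partial>lborel))"
  show "K < \<infinity>"
    using gauss_kernel_moment_finite[OF V, of "Suc k"] gauss_kernel_moment_finite[OF V, of 0]
    unfolding K_def by (simp add: ennreal_mult_less_top)
  have "\<forall>\<^sub>F j in sequentially. norm (d j) < 1"
    using d by (intro order_tendstoD(2)[OF tendsto_norm_zero]) auto
  then show "\<forall>\<^sub>F j in sequentially. (\<integral>\<^sup>+h. ennreal (norm h ^ Suc k * gauss_kernel V (h - d j)) \<partial>lborel) \<le> K"
  proof eventually_elim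
    case (elim j)
    have "(\<integral>\<^sup>+h. ennreal (norm h ^ Suc k * gauss_kernel V (h - d j)) \<partial>lborel)
        = (\<integral>\<^sup>+h. ennreal (norm (h + d j) ^ Suc k * gauss_kernel V h) \<partial>lborel)"
      by (subst nn_integral_lborel_translate[of _ "d j", symmetric]) auto
    also have "\<dots> \<le> (\<integral>\<^sup>+h. ennreal (2 ^ Suc k) * (ennreal (norm h ^ Suc k * gauss_kernel V h) + ennreal (norm h ^ 0 * gauss_kernel V h)) \<partial>lborel)"
    proof (rule nn_integral_mono)
      fix h :: "real^'p"
      have "norm (h + d j) \<le> 2 * max (norm h) 1"
        using norm_triangle_ineq[of h "d j"] elim by auto
      then have "norm (h + d j) ^ Suc k \<le> (2 * max (norm h) 1) ^ Suc k"
        by (intro power_mono) auto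
      also have "\<dots> = 2 ^ Suc k * max (norm h) 1 ^ Suc k" by (rule power_mult_distrib)
      also have "\<dots> \<le> 2 ^ Suc k * (norm h ^ Suc k + 1)"
        by (intro mult_left_mono) (auto simp: max_def)
      finally have "norm (h + d j) ^ Suc k * gauss_kernel V h \<le> 2 ^ Suc k * (norm h ^ Suc k + 1) * gauss_kernel V h"
        using gauss_kernel_pos[of V h] by (intro mult_right_mono) auto
      then have "ennreal (norm (h + d j) ^ Suc k * gauss_kernel V h)
          \<le> ennreal (2 ^ Suc k * (norm h ^ Suc k * gauss_kernel V h + norm h ^ 0 * gauss_kernel V h))"
        by (intro ennreal_leI) (simp add: algebra_simps)
      also have "\<dots> = ennreal (2 ^ Suc k) * (ennreal (norm h ^ Suc k * gauss_kernel V h) + ennreal (norm h ^ 0 * gauss_kernel V h))"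
        by (intro ennreal_mult_add) (auto simp: gauss_kernel_pos less_imp_le)
      finally show "ennreal (norm (h + d j) ^ Suc k * gauss_kernel V h)
          \<le> ennreal (2 ^ Suc k) * (ennreal (norm h ^ Suc k * gauss_kernel V h) + ennreal (norm h ^ 0 * gauss_kernel V h))" .
    qed
    also have "\<dots> = K"
      unfolding K_def by (simp add: nn_integral_cmult nn_integral_add)
    finally show ?case .
  qed
  fix h :: "real^'p"
  have "isCont (gauss_kernel V) h"
    using continuous_gauss_kernel[of UNIV V] by (simp add: continuous_on_eq_continuous_at)
  moreover have "(\<lambda>j. h - d j) \<longlonglongrightarrow> h - 0" by (intro tendsto_intros d)
  ultimately show "(\<lambda>j. gauss_kernel V (h - d j)) \<longlonglongrightarrow> gauss_kernel V h"
    by (auto intro: isCont_tendsto_compose)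
next
  show "\<exists>B. \<forall>\<^sub>F j in sequentially. \<forall>h\<in>cball 0 r. gauss_kernel V (h - d j) \<le> B" for r
    using gauss_kernel_le_1[OF V] by (intro exI[of _ 1]) auto
qed (use gauss_kernel_moment_finite[OF V, of "Suc k"] in \<open>auto simp: gauss_kernel_pos less_imp_le\<close>)

text \<open>
  The deterministic core. Unnormalised kernels that converge locally to a Gaussian and have a bounded
  moment of order \<open>Suc k\<close> converge after normalisation, in the \<open>L\<^sup>1\<close> distance with weight
  \<open>norm h ^ k\<close>: the total masses converge too (the case \<open>m = 0\<close> of the weighted convergence), so
  dividing by them is harmless.
\<close>

lemma normalized_tendsto_gauss:
  fixes V :: "real^'p^'p"
  assumes V: "pos_def_matrix V" and d: "d \<longlonglongrightarrow> 0"
    and [measurable]: "\<And>j. G j \<in> borel_measurable borel"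
    and nonneg: "\<And>j h. G j h \<ge> 0"
    and int: "\<And>j. integrable lborel (G j)"
    and ptw: "\<And>h. (\<lambda>j. G j h) \<longlonglongrightarrow> gauss_kernel V h"
    and bdd: "\<And>r. \<exists>B. \<forall>\<^sub>F j in sequentially. \<forall>h\<in>cball 0 r. G j h \<le> B"
    and mom: "\<forall>\<^sub>F j in sequentially. (\<integral>\<^sup>+h. ennreal (norm h ^ Suc k * G j h) \<partial>lborel) \<le> K" "K < \<infinity>"
  shows "(\<lambda>j. \<integral>\<^sup>+h. ennreal (norm h ^ k * \<bar>G j h / integral\<^sup>L lborel (G j)
      - gauss_kernel V (h - d j) / integral\<^sup>L lborel (gauss_kernel V)\<bar>) \<partial>lborel) \<longlonglongrightarrow> 0"
proof -
  define g where "g = gauss_kernel V"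
  have [measurable]: "g \<in> borel_measurable borel" by (simp add: g_def)
  have g0: "g h \<ge> 0" for h by (simp add: g_def gauss_kernel_pos less_imp_le)
  define Z where "Z = integral\<^sup>L lborel g"
  define Zj where "Zj = (\<lambda>j. integral\<^sup>L lborel (G j))"
  have Z: "Z > 0" unfolding Z_def g_def by (rule integral_gauss_kernel(2)[OF V])
  have gi: "integrable lborel g" unfolding g_def by (rule integrable_gauss_kernel[OF V])
  have conv: "(\<lambda>j. \<integral>\<^sup>+h. ennreal (norm h ^ m * \<bar>G j h - g h\<bar>) \<partial>lborel) \<longlonglongrightarrow> 0" if "m \<le> k" for m
    unfolding g_def
    by (rule tendsto_0_weighted_L1[OF _ _ nonneg _ ptw bdd mom gauss_kernel_moment_finite[OF V] that])
       (auto simp: gauss_kernel_pos less_imp_le)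
  have "(\<lambda>j. ennreal \<bar>Zj j - Z\<bar>) \<longlonglongrightarrow> 0"
  proof (rule tendsto_sandwich[OF _ _ tendsto_const conv[of 0]])
    have "ennreal \<bar>Zj j - Z\<bar> \<le> (\<integral>\<^sup>+h. ennreal (norm h ^ 0 * \<bar>G j h - g h\<bar>) \<partial>lborel)" for j
    proof -
      have "\<bar>Zj j - Z\<bar> = \<bar>LINT h|lborel. G j h - g h\<bar>"
        using int gi by (simp add: Zj_def Z_def)
      also have "\<dots> \<le> (LINT h|lborel. \<bar>G j h - g h\<bar>)"
        by (rule integral_abs_bound)
      finally have "ennreal \<bar>Zj j - Z\<bar> \<le> ennreal (LINT h|lborel. \<bar>G j h - g h\<bar>)"
        by (rule ennreal_leI)
      also have "\<dots> = (\<integral>\<^sup>+h. ennreal \<bar>G j h - g h\<bar> \<partial>lborel)"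
        using int gi by (subst nn_integral_eq_integral) auto
      finally show ?thesis by simp
    qed
    then show "\<forall>\<^sub>F j in sequentially. ennreal \<bar>Zj j - Z\<bar> \<le> (\<integral>\<^sup>+h. ennreal (norm h ^ 0 * \<bar>G j h - g h\<bar>) \<partial>lborel)"
      by simp
  qed auto
  then have "(\<lambda>j. \<bar>Zj j - Z\<bar>) \<longlonglongrightarrow> 0"
    by (subst (asm) ennreal_tendsto_0_iff) auto
  then have ZjZ: "Zj \<longlonglongrightarrow> Z"
    using LIM_zero_cancel tendsto_rabs_zero_iff by blast
  define A where "A = (\<lambda>j. \<integral>\<^sup>+h. ennreal (norm h ^ k * \<bar>G j h - g h\<bar>) \<partial>lborel)"
  define Y where "Y = (\<lambda>j. \<integral>\<^sup>+h. ennreal (norm h ^ k * \<bar>g (h - d j) - g h\<bar>) \<partial>lborel)"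
  define m where "m = (\<integral>\<^sup>+h. ennreal (norm h ^ k * g h) \<partial>lborel)"
  have m: "m < \<infinity>" unfolding m_def g_def by (rule gauss_kernel_moment_finite[OF V])
  have Zge: "\<forall>\<^sub>F j in sequentially. Zj j > Z / 2"
    using Z by (intro order_tendstoD(1)[OF ZjZ]) auto
  have "\<forall>\<^sub>F j in sequentially. (\<integral>\<^sup>+h. ennreal (norm h ^ k * \<bar>G j h / Zj j - g (h - d j) / Z\<bar>) \<partial>lborel)
      \<le> ennreal (2 / Z) * A j + (ennreal \<bar>1 / Zj j - 1 / Z\<bar> * m + ennreal (1 / Z) * Y j)"
    using Zge
  proof eventually_elim
    case (elim j)
    have "ennreal (norm h ^ k * \<bar>G j h / Zj j - g (h - d j) / Z\<bar>)
        \<le> ennreal (2 / Z) * ennreal (norm h ^ k * \<bar>G j h - g h\<bar>)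
          + (ennreal \<bar>1 / Zj j - 1 / Z\<bar> * ennreal (norm h ^ k * g h)
             + ennreal (1 / Z) * ennreal (norm h ^ k * \<bar>g (h - d j) - g h\<bar>))" for h
    proof -
      have Zj: "Zj j > 0" "1 / Zj j \<le> 2 / Z" using elim Z by (auto simp: field_simps)
      have "G j h / Zj j - g (h - d j) / Z = (1 / Zj j) * (G j h - g h) + (1 / Zj j - 1 / Z) * g h - (1 / Z) * (g (h - d j) - g h)"
        by (simp add: algebra_simps diff_divide_distrib)
      also have "\<bar>\<dots>\<bar> \<le> (1 / Zj j) * \<bar>G j h - g h\<bar> + \<bar>1 / Zj j - 1 / Z\<bar> * g h + (1 / Z) * \<bar>g (h - d j) - g h\<bar>"
        using Zj Z g0[of h]
        by (intro order_trans[OF abs_triangle_ineq4] add_mono order_trans[OF abs_triangle_ineq])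
           (auto simp: abs_mult)
      also have "\<dots> \<le> (2 / Z) * \<bar>G j h - g h\<bar> + \<bar>1 / Zj j - 1 / Z\<bar> * g h + (1 / Z) * \<bar>g (h - d j) - g h\<bar>"
        using Zj by (intro add_mono mult_right_mono order_refl) auto
      finally have "norm h ^ k * \<bar>G j h / Zj j - g (h - d j) / Z\<bar>
         \<le> norm h ^ k * ((2 / Z) * \<bar>G j h - g h\<bar> + \<bar>1 / Zj j - 1 / Z\<bar> * g h + (1 / Z) * \<bar>g (h - d j) - g h\<bar>)"
        by (intro mult_left_mono) auto
      also have "\<dots> = (2 / Z) * (norm h ^ k * \<bar>G j h - g h\<bar>) + (\<bar>1 / Zj j - 1 / Z\<bar> * (norm h ^ k * g h)
          + (1 / Z) * (norm h ^ k * \<bar>g (h - d j) - g h\<bar>))"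
        by (simp add: algebra_simps)
      finally show ?thesis
        by (simp add: ennreal_mult[symmetric] ennreal_plus[symmetric] Z less_imp_le g0 ennreal_leI del: ennreal_plus)
    qed
    then have "(\<integral>\<^sup>+h. ennreal (norm h ^ k * \<bar>G j h / Zj j - g (h - d j) / Z\<bar>) \<partial>lborel)
      \<le> (\<integral>\<^sup>+h. ennreal (2 / Z) * ennreal (norm h ^ k * \<bar>G j h - g h\<bar>)
          + (ennreal \<bar>1 / Zj j - 1 / Z\<bar> * ennreal (norm h ^ k * g h)
             + ennreal (1 / Z) * ennreal (norm h ^ k * \<bar>g (h - d j) - g h\<bar>)) \<partial>lborel)"
      by (rule nn_integral_mono)
    also have "\<dots> = ennreal (2 / Z) * A j + (ennreal \<bar>1 / Zj j - 1 / Z\<bar> * m + ennreal (1 / Z) * Y j)"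
      unfolding A_def Y_def m_def by (simp add: nn_integral_cmult nn_integral_add)
    finally show ?case .
  qed
  note bound = this
  have "(\<lambda>j. ennreal (2 / Z) * A j + (ennreal \<bar>1 / Zj j - 1 / Z\<bar> * m + ennreal (1 / Z) * Y j)) \<longlonglongrightarrow>
      ennreal (2 / Z) * 0 + (ennreal \<bar>1 / Z - 1 / Z\<bar> * m + ennreal (1 / Z) * 0)"
  proof -
    obtain m' where m': "m = ennreal m'" "m' \<ge> 0" using m by (cases m) auto
    have "(\<lambda>j. ennreal (\<bar>1 / Zj j - 1 / Z\<bar> * m')) \<longlonglongrightarrow> ennreal (\<bar>1 / Z - 1 / Z\<bar> * m')"
      using Z by (intro tendsto_ennrealI tendsto_intros ZjZ) auto
    then have "(\<lambda>j. ennreal \<bar>1 / Zj j - 1 / Z\<bar> * m) \<longlonglongrightarrow> ennreal \<bar>1 / Z - 1 / Z\<bar> * m"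
      using m' by (simp add: ennreal_mult)
    moreover have "A \<longlonglongrightarrow> 0" unfolding A_def by (rule conv) simp
    moreover have "Y \<longlonglongrightarrow> 0"
      unfolding Y_def g_def by (rule gauss_kernel_translate_tendsto[OF V d])
    ultimately show ?thesis
      by (intro tendsto_add ennreal_tendsto_cmult) auto
  qed
  then have lim: "(\<lambda>j. ennreal (2 / Z) * A j + (ennreal \<bar>1 / Zj j - 1 / Z\<bar> * m + ennreal (1 / Z) * Y j)) \<longlonglongrightarrow> 0"
    by simp
  have "(\<lambda>j. \<integral>\<^sup>+h. ennreal (norm h ^ k * \<bar>G j h / Zj j - g (h - d j) / Z\<bar>) \<partial>lborel) \<longlonglongrightarrow> 0"
    by (rule tendsto_sandwich[OF _ bound tendsto_const lim]) simp
  then show ?thesis by (simp add: g_def Zj_def Z_def)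
qed

section \<open>The posterior of one sample in local coordinates\<close>

text \<open>
  A bound on a normalised moment also bounds the unnormalised one as soon as the kernel is bounded on a
  ball: by Markov's inequality at least half of the mass lies in the ball of radius \<open>r\<close>, whence
  the total mass is at most twice \<open>B\<close> times the volume of the ball.
\<close>

lemma moment_bound_from_ratio:
  fixes w :: "'a::euclidean_space \<Rightarrow> real"
  assumes w: "integrable lborel w" "\<And>h. w h \<ge> 0"
    and ratio: "(\<integral>\<^sup>+h. ennreal (norm h ^ Suc k * w h) \<partial>lborel) \<le> ennreal (M * integral\<^sup>L lborel w)"
    and M: "M \<ge> 0" and r: "r \<ge> 1" "r \<ge> 2 * M"
    and B: "\<And>h. h \<in> cball 0 r \<Longrightarrow> w h \<le> B"
  shows "(\<integral>\<^sup>+h. ennreal (norm h ^ Suc k * w h) \<partial>lborel)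
    \<le> ennreal (M * (2 * B * measure lborel (cball (0::'a) r)))"
proof -
  define Z where "Z = integral\<^sup>L lborel w"
  define v where "v = measure lborel (cball (0::'a) r)"
  have [measurable]: "w \<in> borel_measurable borel" using borel_measurable_integrable[OF w(1)] by simp
  have Z: "Z \<ge> 0" unfolding Z_def using w(2) by (intro integral_nonneg_AE) auto
  have "B \<ge> 0" using w(2)[of 0] B[of 0] r by simp
  have v: "emeasure lborel (cball (0::'a) r) = ennreal v"
    unfolding v_def by (intro emeasure_eq_ennreal_measure less_imp_neq emeasure_bounded_finite[unfolded infinity_ennreal_def]) simp
  have [measurable]: "cball (0::'a) r \<in> sets borel" by simp
  have pt: "ennreal (w h) \<le> ennreal B * indicator (cball 0 r) h + ennreal (1 / r) * ennreal (norm h ^ Suc k * w h)" for h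
  proof (cases "h \<in> cball 0 r")
    case True
    then show ?thesis using B[OF True] by (simp add: add_increasing2 ennreal_leI)
  next
    case False
    then have h: "norm h > r" by simp
    then have "1 \<le> norm h ^ k" using r by (intro one_le_power) auto
    then have "r * 1 \<le> norm h * norm h ^ k" using h r by (intro mult_mono) auto
    then have "1 \<le> (1 / r) * norm h ^ Suc k" using r by (simp add: field_simps)
    then have "1 * w h \<le> (1 / r) * norm h ^ Suc k * w h" using w(2) by (intro mult_right_mono)
    then show ?thesis
      using r False w(2) by (simp add: ennreal_mult[symmetric] ennreal_leI mult.assoc)
  qed
  have "ennreal Z = (\<integral>\<^sup>+h. ennreal (w h) \<partial>lborel)"
    unfolding Z_def using w by (subst nn_integral_eq_integral) auto
  also have "\<dots> \<le> (\<integral>\<^sup>+h. ennreal B * indicator (cball 0 r) h + ennreal (1 / r) * ennreal (norm h ^ Suc k * w h) \<partial>lborel)"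
    by (intro nn_integral_mono pt)
  also have "\<dots> = ennreal B * ennreal v + ennreal (1 / r) * (\<integral>\<^sup>+h. ennreal (norm h ^ Suc k * w h) \<partial>lborel)"
    by (subst nn_integral_add, simp, simp, subst nn_integral_cmult, simp) (simp add: nn_integral_cmult v)
  also have "\<dots> \<le> ennreal B * ennreal v + ennreal (1 / r) * ennreal (M * Z)"
    using ratio unfolding Z_def by (intro add_mono mult_left_mono) auto
  also have "\<dots> = ennreal (B * v + (1 / r) * (M * Z))"
    using \<open>B \<ge> 0\<close> M Z r by (simp add: ennreal_mult[symmetric] ennreal_plus[symmetric] v_def del: ennreal_plus)
  finally have "Z \<le> B * v + (1 / r) * (M * Z)"
    using \<open>B \<ge> 0\<close> M Z r by (subst (asm) ennreal_le_iff) (auto simp: v_def)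
  moreover have "(1 / r) * (M * Z) \<le> (1 / 2) * Z"
  proof -
    have "M / r \<le> 1 / 2" using r by (simp add: field_simps)
    then have "M / r * Z \<le> 1 / 2 * Z" using Z by (rule mult_right_mono)
    then show ?thesis by simp
  qed
  ultimately have "Z \<le> 2 * B * v" by linarith
  then have "M * Z \<le> M * (2 * B * v)" using M by (intro mult_left_mono)
  then show ?thesis
    using ratio unfolding Z_def v_def by (meson ennreal_leI order_trans)
qed

text \<open>
  This is how a random exponent is controlled by two deterministic ones: \<open>t powr b\<close> is below
  \<open>t powr a\<close> for \<open>t \<le> 1\<close> and below \<open>t powr c\<close> for \<open>t \<ge> 1\<close>.
\<close>

lemma powr_le_sum_powr:
  fixes t :: real
  assumes "t \<ge> 0" "a \<le> b" "b \<le> c"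
  shows "t powr b \<le> t powr a + t powr c"
proof (cases "t \<le> 1")
  case True
  then have "t powr b \<le> t powr a" using assms by (intro powr_mono') auto
  then show ?thesis by (simp add: add_increasing2)
next
  case False
  then have "t powr b \<le> t powr c" using assms by (intro powr_mono) auto
  then show ?thesis by (simp add: add_increasing)
qed

text \<open>
  The unnormalised posterior in the local coordinate \<open>h = s (\<theta> - \<theta>0)\<close>. Dividing by its value at
  \<open>\<theta>0\<close> does not change the posterior, and it is what makes a limit possible: the kernels at the
  different exponents \<open>a\<close> all take the value \<open>1\<close> at \<open>h = 0\<close>.
\<close>

definition local_kernel ::
    "(nat \<Rightarrow> real^'p \<Rightarrow> 'a \<Rightarrow> real) \<Rightarrow> (real^'p) set \<Rightarrow> (real^'p \<Rightarrow> real) \<Rightarrow> real^'p \<Rightarrow> real \<Rightarrow>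
     nat \<Rightarrow> real \<Rightarrow> 'a \<Rightarrow> real^'p \<Rightarrow> real" where
  "local_kernel f \<Theta> prior \<theta>0 s n a x h =
     posterior_kernel f \<Theta> prior n a x (\<theta>0 + (1 / s) *\<^sub>R h) / (f n \<theta>0 x powr a * prior \<theta>0)"

text \<open>
  One sample \<open>x\<close> of size \<open>n\<close> and one exponent \<open>a\<close>: the passage between the posterior and its local
  kernel is a linear substitution, in which the Jacobian cancels between the density and the volume
  element.
\<close>

locale localization =
  fixes f :: "nat \<Rightarrow> real^'p \<Rightarrow> 'a \<Rightarrow> real" and \<Theta> :: "(real^'p) set" and prior :: "real^'p \<Rightarrow> real"
    and \<theta>0 :: "real^'p" and s :: real and n :: nat and x :: 'a and a :: real
  assumes s: "s > 0" and f0: "f n \<theta>0 x > 0" and p0: "prior \<theta>0 > 0"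
    and meas: "posterior_kernel f \<Theta> prior n a x \<in> borel_measurable borel"
    and prior_nonneg: "\<And>\<theta>. \<theta> \<in> \<Theta> \<Longrightarrow> prior \<theta> \<ge> 0"
    and proper: "proper_posterior f \<Theta> prior n a x"
begin

abbreviation "w \<equiv> local_kernel f \<Theta> prior \<theta>0 s n a x"

lemma kernel_nonneg: "posterior_kernel f \<Theta> prior n a x \<theta> \<ge> 0"
  using prior_nonneg by (simp add: posterior_kernel_def indicator_def)

lemma local_kernel_nonneg: "w h \<ge> 0"
  using kernel_nonneg f0 p0 by (simp add: local_kernel_def)

lemma local_kernel_measurable [measurable]: "w \<in> borel_measurable borel"
proof -
  note meas[measurable]
  show ?thesis unfolding local_kernel_def[abs_def] by measurable
qed

lemma nn_integral_local_kernel: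
  "(\<integral>\<^sup>+\<theta>. ennreal (posterior_kernel f \<Theta> prior n a x \<theta>) \<partial>lborel)
    = ennreal ((1 / s) ^ CARD('p) * (f n \<theta>0 x powr a * prior \<theta>0)) * (\<integral>\<^sup>+h. ennreal (w h) \<partial>lborel)"
proof -
  note meas[measurable]
  define c where "c = f n \<theta>0 x powr a * prior \<theta>0"
  have c: "c > 0" using f0 p0 by (simp add: c_def)
  have "posterior_kernel f \<Theta> prior n a x (\<theta>0 + (1 / s) *\<^sub>R h) = c * w h" for h
    using c by (simp add: local_kernel_def c_def[symmetric])
  then show ?thesis
    using s c local_kernel_nonneg
    by (subst nn_integral_lborel_affine[of _ "1 / s" \<theta>0])
       (auto simp: ennreal_mult nn_integral_cmult mult.assoc c_def[symmetric])
qed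

lemma local_kernel_integrable: "integrable lborel w"
proof (rule integrableI_nonneg)
  have "(\<integral>\<^sup>+\<theta>. ennreal (posterior_kernel f \<Theta> prior n a x \<theta>) \<partial>lborel) < \<infinity>"
    using proper kernel_nonneg unfolding proper_posterior_def
    by (subst nn_integral_eq_integral) auto
  then show "(\<integral>\<^sup>+h. ennreal (w h) \<partial>lborel) < \<infinity>"
    using s f0 p0 unfolding nn_integral_local_kernel by (auto simp: ennreal_mult_less_top)
qed (use local_kernel_nonneg in auto)

lemma posterior_local:
  "posterior f \<Theta> prior n a x (\<theta>0 + (1 / s) *\<^sub>R h) = s ^ CARD('p) * (w h / integral\<^sup>L lborel w)"
proof -
  define c where "c = f n \<theta>0 x powr a * prior \<theta>0"
  have c: "c > 0" using f0 p0 by (simp add: c_def)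
  have "ennreal (integral\<^sup>L lborel (posterior_kernel f \<Theta> prior n a x))
      = ennreal ((1 / s) ^ CARD('p) * c) * ennreal (integral\<^sup>L lborel w)"
    using nn_integral_local_kernel proper kernel_nonneg local_kernel_integrable local_kernel_nonneg
    unfolding proper_posterior_def c_def by (subst (1 2) nn_integral_eq_integral[symmetric]) auto
  then have "integral\<^sup>L lborel (posterior_kernel f \<Theta> prior n a x) = (1 / s) ^ CARD('p) * c * integral\<^sup>L lborel w"
    using s c kernel_nonneg local_kernel_nonneg
    by (subst (asm) ennreal_mult[symmetric], simp, simp) (subst (asm) ennreal_inj; simp)
  note eq = this
  show ?thesis
    unfolding posterior_def eq local_kernel_def c_def[symmetric]
    using s c by (simp add: power_one_over)
qed

lemma moment_local:
  assumes moment: "(\<integral>\<^sup>+\<theta>. ennreal (norm ((c * s) *\<^sub>R (\<theta> - \<theta>0)) ^ k * posterior f \<Theta> prior n a x \<theta>) \<partial>lborel) \<le> ennreal M"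
    and M: "M \<ge> 0" and c: "c > 0"
  shows "(\<integral>\<^sup>+h. ennreal (norm h ^ k * w h) \<partial>lborel) \<le> ennreal (M / c ^ k * integral\<^sup>L lborel w)"
proof (cases "integral\<^sup>L lborel w = 0")
  case True
  \<comment> \<open>The posterior is then a division by zero and its moment says nothing, but the kernel itself
    vanishes almost everywhere.\<close>
  then have "AE h in lborel. w h = 0"
    using integral_nonneg_eq_0_iff_AE[OF local_kernel_integrable] local_kernel_nonneg by auto
  then have "(\<integral>\<^sup>+h. ennreal (norm h ^ k * w h) \<partial>lborel) = 0"
    by (subst nn_integral_0_iff_AE) auto
  then show ?thesis by simp
next
  case False
  note meas[measurable]
  define Z where "Z = integral\<^sup>L lborel w"
  have "Z \<ge> 0" unfolding Z_def using local_kernel_nonneg by (intro integral_nonneg_AE) auto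
  with False have Z: "Z > 0" by (simp add: Z_def)
  have [measurable]: "posterior f \<Theta> prior n a x \<in> borel_measurable borel"
    unfolding posterior_def[abs_def] by measurable
  have "(\<integral>\<^sup>+\<theta>. ennreal (norm ((c * s) *\<^sub>R (\<theta> - \<theta>0)) ^ k * posterior f \<Theta> prior n a x \<theta>) \<partial>lborel)
      = ennreal ((1 / s) ^ CARD('p)) * (\<integral>\<^sup>+h. ennreal (norm (c *\<^sub>R h) ^ k * (s ^ CARD('p) * (w h / Z))) \<partial>lborel)"
    using s by (subst nn_integral_lborel_affine[of _ "1 / s" \<theta>0]) (auto simp: posterior_local Z_def)
  also have "\<dots> = (\<integral>\<^sup>+h. ennreal (c ^ k / Z) * ennreal (norm h ^ k * w h) \<partial>lborel)"
    using s c Z local_kernel_nonneg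
    by (subst nn_integral_cmult[symmetric])
       (auto intro!: nn_integral_cong simp: ennreal_mult[symmetric] power_mult_distrib field_simps)
  also have "\<dots> = ennreal (c ^ k / Z) * (\<integral>\<^sup>+h. ennreal (norm h ^ k * w h) \<partial>lborel)"
    by (rule nn_integral_cmult) simp
  finally have *: "ennreal (c ^ k / Z) * (\<integral>\<^sup>+h. ennreal (norm h ^ k * w h) \<partial>lborel) \<le> ennreal M"
    using moment by simp
  have "(\<integral>\<^sup>+h. ennreal (norm h ^ k * w h) \<partial>lborel)
     = ennreal (Z / c ^ k) * (ennreal (c ^ k / Z) * (\<integral>\<^sup>+h. ennreal (norm h ^ k * w h) \<partial>lborel))"
    using c Z by (simp add: mult.assoc[symmetric] ennreal_mult[symmetric])
  also have "\<dots> \<le> ennreal (Z / c ^ k) * ennreal M"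
    by (intro mult_left_mono *) simp
  also have "\<dots> = ennreal (M / c ^ k * Z)"
    using c Z M by (simp add: ennreal_mult[symmetric] mult.commute)
  finally show ?thesis by (simp add: Z_def)
qed

lemma posterior_mvn_distance_local:
  assumes V: "pos_def_matrix V"
  shows "(\<integral>\<^sup>+\<theta>. ennreal (norm (s *\<^sub>R (\<theta> - \<theta>0)) ^ k *
      \<bar>posterior f \<Theta> prior n a x \<theta> - mvn_density \<mu> ((1 / s\<^sup>2) *\<^sub>R matrix_inv V) \<theta>\<bar>) \<partial>lborel)
    = (\<integral>\<^sup>+h. ennreal (norm h ^ k * \<bar>w h / integral\<^sup>L lborel w
      - gauss_kernel V (h - s *\<^sub>R (\<mu> - \<theta>0)) / integral\<^sup>L lborel (gauss_kernel V)\<bar>) \<partial>lborel)"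
proof -
  note meas[measurable]
  have [measurable]: "posterior f \<Theta> prior n a x \<in> borel_measurable borel"
    unfolding posterior_def[abs_def] by measurable
  have [measurable]: "mvn_density \<mu> ((1 / s\<^sup>2) *\<^sub>R matrix_inv V) \<in> borel_measurable borel"
  proof -
    have [measurable]: "(*v) A \<in> borel_measurable borel" for A :: "real^'p^'p"
      by (intro borel_measurable_continuous_onI matrix_vector_mult_linear_continuous_on)
    show ?thesis unfolding mvn_density_def[abs_def] by measurable
  qed
  have key: "ennreal ((1 / s) ^ CARD('p)) * ennreal (N * \<bar>s ^ CARD('p) * u - s ^ CARD('p) * v\<bar>) = ennreal (N * \<bar>u - v\<bar>)"
    if "N \<ge> 0" for N u v :: real
  proof -
    have "(1 / s) ^ CARD('p) * (N * \<bar>s ^ CARD('p) * u - s ^ CARD('p) * v\<bar>) = N * \<bar>u - v\<bar>"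
      using s unfolding right_diff_distrib[symmetric] by (simp add: abs_mult power_one_over)
    then show ?thesis using s that by (simp add: ennreal_mult[symmetric] del: times_divide_eq_left)
  qed
  have "\<bar>1 / s\<bar> ^ DIM(real^'p) = (1 / s) ^ CARD('p)" using s by simp
  moreover have "s *\<^sub>R (\<theta>0 + (1 / s) *\<^sub>R h - \<theta>0) = h" for h using s by simp
  ultimately show ?thesis
    using s
    by (subst nn_integral_lborel_affine[of _ "1 / s" \<theta>0])
       (simp_all only: posterior_local mvn_density_local_coordinates[OF V s] nn_integral_cmult[symmetric] key
          zero_le_power norm_ge_zero, auto intro!: nn_integral_cong simp: nn_integral_cmult[symmetric] key
           simp del: times_divide_eq_right)
qed

end

text \<open>
  A finite remainder forces the likelihood to be positive at both points: where it vanishes, the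
  extended-real log-likelihood makes the remainder infinite.
\<close>

lemma lan_remainder_bounded:
  assumes a: "\<alpha> n > 0" and e: "e \<ge> 0"
    and R: "e2ennreal \<bar>lan_remainder f \<theta>hat \<theta>0 V \<alpha> n x h\<bar> \<le> ennreal e"
  shows "f n \<theta>0 x > 0" "f n (\<theta>0 + (1 / sqrt (\<alpha> n * real n)) *\<^sub>R h) x > 0"
    "\<bar>\<alpha> n * (ln (f n (\<theta>0 + (1 / sqrt (\<alpha> n * real n)) *\<^sub>R h) x) - ln (f n \<theta>0 x))
      - sqrt (\<alpha> n) * (h \<bullet> (V *v \<Delta>\<^sub>n \<theta>hat \<theta>0 n x)) + 1 / 2 * (h \<bullet> (V *v h))\<bar> \<le> e"
proof -
  have "\<bar>lan_remainder f \<theta>hat \<theta>0 V \<alpha> n x h\<bar> = enn2ereal (e2ennreal \<bar>lan_remainder f \<theta>hat \<theta>0 V \<alpha> n x h\<bar>)"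
    by (simp add: enn2ereal_e2ennreal)
  also have "\<dots> \<le> enn2ereal (ennreal e)" using R by (simp add: less_eq_ennreal.rep_eq)
  also have "\<dots> = ereal e" using e by simp
  finally have le: "\<bar>lan_remainder f \<theta>hat \<theta>0 V \<alpha> n x h\<bar> \<le> ereal e" .
  show 1: "f n \<theta>0 x > 0"
  proof (rule ccontr)
    assume "\<not> f n \<theta>0 x > 0"
    then show False using le a by (simp add: lan_remainder_def log_lik_def)
  qed
  show 2: "f n (\<theta>0 + (1 / sqrt (\<alpha> n * real n)) *\<^sub>R h) x > 0"
  proof (rule ccontr)
    assume "\<not> f n (\<theta>0 + (1 / sqrt (\<alpha> n * real n)) *\<^sub>R h) x > 0"
    then show False using le a 1 by (simp add: lan_remainder_def log_lik_def)
  qed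
  show "\<bar>\<alpha> n * (ln (f n (\<theta>0 + (1 / sqrt (\<alpha> n * real n)) *\<^sub>R h) x) - ln (f n \<theta>0 x))
      - sqrt (\<alpha> n) * (h \<bullet> (V *v \<Delta>\<^sub>n \<theta>hat \<theta>0 n x)) + 1 / 2 * (h \<bullet> (V *v h))\<bar> \<le> e"
    using le 1 2 by (simp add: lan_remainder_def log_lik_def)
qed

section \<open>Posteriors along a sequence of good samples\<close>

text \<open>
  A sequence of samples \<open>x j\<close> of sizes \<open>n j\<close> along which the probabilistic assumptions hold with
  tolerances tending to zero; \<open>b j\<close> is the realised value of the plug-in exponent. The quadratic
  expansion holds with error \<open>1 / Suc j\<close> on the ball of radius \<open>Suc j\<close>, so that eventually it
  covers every fixed ball. The moment bound is required at the exponents \<open>\<alpha> / 2\<close> and \<open>2 \<alpha>\<close>, which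
  eventually enclose \<open>b j\<close>.
\<close>

locale good_samples =
  fixes f :: "nat \<Rightarrow> real^'p \<Rightarrow> 'a \<Rightarrow> real" and \<Theta> :: "(real^'p) set" and prior :: "real^'p \<Rightarrow> real"
    and \<theta>hat :: "nat \<Rightarrow> 'a \<Rightarrow> real^'p" and \<theta>0 :: "real^'p" and V :: "real^'p^'p"
    and \<alpha> :: "nat \<Rightarrow> real" and k :: nat and M :: real
    and n :: "nat \<Rightarrow> nat" and x :: "nat \<Rightarrow> 'a" and b :: "nat \<Rightarrow> real"
  assumes V: "pos_def_matrix V" and \<Theta>: "open \<Theta>" "\<theta>0 \<in> \<Theta>"
    and A1: "assumption_A1 prior \<theta>0" and prior_nonneg: "\<And>\<theta>. \<theta> \<in> \<Theta> \<Longrightarrow> prior \<theta> \<ge> 0"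
    and f_nonneg: "\<And>j \<theta>. \<theta> \<in> \<Theta> \<Longrightarrow> f (n j) \<theta> (x j) \<ge> 0"
    and meas: "\<And>j e. posterior_kernel f \<Theta> prior (n j) e (x j) \<in> borel_measurable borel"
    and \<alpha>_pos: "\<And>j. \<alpha> (n j) > 0" and n_pos: "\<And>j. n j \<ge> 1"
    and scale: "filterlim (\<lambda>j. sqrt (\<alpha> (n j) * real (n j))) at_top sequentially"
    and ratio: "(\<lambda>j. b j / \<alpha> (n j)) \<longlonglongrightarrow> 1"
    and proper: "\<And>j. proper_posterior f \<Theta> prior (n j) (b j) (x j)"
    and proper': "\<And>c j. c \<in> {1/2, 2} \<Longrightarrow> proper_posterior f \<Theta> prior (n j) (c * \<alpha> (n j)) (x j)"
    and centre: "(\<lambda>j. sqrt (\<alpha> (n j)) *\<^sub>R \<Delta>\<^sub>n \<theta>hat \<theta>0 (n j) (x j)) \<longlonglongrightarrow> 0"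
    and LAN: "\<And>j h. h \<in> cball 0 (real (Suc j)) \<Longrightarrow>
      e2ennreal \<bar>lan_remainder f \<theta>hat \<theta>0 V \<alpha> (n j) (x j) h\<bar> \<le> ennreal (1 / real (Suc j))"
    and M: "M \<ge> 0"
    and moments: "\<And>c j. c \<in> {1/2, 2} \<Longrightarrow>
      (\<integral>\<^sup>+\<theta>. ennreal (norm (sqrt (c * \<alpha> (n j) * real (n j)) *\<^sub>R (\<theta> - \<theta>0)) powr real (Suc k) *
          posterior f \<Theta> prior (n j) (c * \<alpha> (n j)) (x j) \<theta>) \<partial>lborel) \<le> ennreal M"
begin

definition s :: "nat \<Rightarrow> real" where "s j = sqrt (\<alpha> (n j) * real (n j))"
definition d :: "nat \<Rightarrow> real^'p" where "d j = sqrt (\<alpha> (n j)) *\<^sub>R \<Delta>\<^sub>n \<theta>hat \<theta>0 (n j) (x j)"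
definition loc :: "nat \<Rightarrow> real^'p \<Rightarrow> real^'p" where "loc j h = \<theta>0 + (1 / s j) *\<^sub>R h"
definition llr :: "nat \<Rightarrow> real^'p \<Rightarrow> real" where
  "llr j h = \<alpha> (n j) * (ln (f (n j) (loc j h) (x j)) - ln (f (n j) \<theta>0 (x j)))"
abbreviation w :: "(nat \<Rightarrow> real) \<Rightarrow> nat \<Rightarrow> real^'p \<Rightarrow> real" where
  "w e j \<equiv> local_kernel f \<Theta> prior \<theta>0 (s j) (n j) (e j) (x j)"

lemma s_pos: "s j > 0"
  using \<alpha>_pos[of j] n_pos[of j] by (simp add: s_def)

lemma d_eq: "d j = s j *\<^sub>R (\<theta>hat (n j) (x j) - \<theta>0)"
  by (simp add: d_def s_def \<Delta>\<^sub>n_def real_sqrt_mult)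

lemma lik_pos:
  assumes "norm h \<le> real (Suc j)"
  shows "f (n j) \<theta>0 (x j) > 0" "f (n j) (loc j h) (x j) > 0"
    "\<bar>llr j h - h \<bullet> (V *v d j) + (h \<bullet> (V *v h)) / 2\<bar> \<le> 1 / real (Suc j)"
proof -
  have "h \<in> cball 0 (real (Suc j))" using assms by simp
  note * = lan_remainder_bounded[of \<alpha>, OF \<alpha>_pos _ LAN[OF this]]
  show "f (n j) \<theta>0 (x j) > 0" "f (n j) (loc j h) (x j) > 0"
    using *(1,2) by (auto simp: loc_def s_def)
  show "\<bar>llr j h - h \<bullet> (V *v d j) + (h \<bullet> (V *v h)) / 2\<bar> \<le> 1 / real (Suc j)"
    using *(3) by (simp add: llr_def loc_def s_def d_def matrix_vector_mult_scaleR)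
qed

lemma f0_pos: "f (n j) \<theta>0 (x j) > 0"
  using lik_pos(1)[of 0 j] by simp

lemma prior0_pos: "prior \<theta>0 > 0"
  using A1 by (auto simp: assumption_A1_def)

lemma localization:
  assumes "proper_posterior f \<Theta> prior (n j) e (x j)"
  shows "localization f \<Theta> prior \<theta>0 (s j) (n j) (x j) e"
  by unfold_locales (use assms s_pos f0_pos prior0_pos meas prior_nonneg in auto)

lemma prior_continuous: "isCont prior \<theta>0"
  using A1 by (auto simp: assumption_A1_def continuous_on_eq_continuous_at)

lemma loc_near:
  "\<forall>\<^sub>F j in sequentially. \<forall>h\<in>cball 0 r. loc j h \<in> \<Theta> \<and> prior (loc j h) \<le> 2 * prior \<theta>0"
proof -
  have "\<forall>\<^sub>F \<theta> in nhds \<theta>0. prior \<theta> < 2 * prior \<theta>0"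
    using prior_continuous prior0_pos
    by (intro order_tendstoD(2)[of prior "prior \<theta>0"]) (auto simp: isCont_def tendsto_at_iff_tendsto_nhds)
  moreover have "\<forall>\<^sub>F \<theta> in nhds \<theta>0. \<theta> \<in> \<Theta>"
    using \<Theta> by (rule eventually_nhds_in_open)
  ultimately have "\<forall>\<^sub>F \<theta> in nhds \<theta>0. \<theta> \<in> \<Theta> \<and> prior \<theta> < 2 * prior \<theta>0"
    by eventually_elim auto
  then obtain \<delta> where \<delta>: "\<delta> > 0" "\<And>\<theta>. dist \<theta> \<theta>0 < \<delta> \<Longrightarrow> \<theta> \<in> \<Theta> \<and> prior \<theta> < 2 * prior \<theta>0"
    by (auto simp: eventually_nhds_metric)
  have "\<forall>\<^sub>F j in sequentially. s j > r / \<delta>"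
    using scale unfolding s_def filterlim_at_top_dense by blast
  then show ?thesis
  proof eventually_elim
    case (elim j)
    have "dist (loc j h) \<theta>0 < \<delta>" if "h \<in> cball 0 r" for h
    proof -
      have "dist (loc j h) \<theta>0 = norm h / s j"
        using s_pos[of j] by (simp add: loc_def dist_norm)
      also have "\<dots> < \<delta>" using that elim \<delta> s_pos[of j] by (simp add: field_simps)
      finally show ?thesis .
    qed
    then show ?case using \<delta>(2) by (auto intro: less_imp_le)
  qed
qed

lemma loc_tendsto: "(\<lambda>j. loc j h) \<longlonglongrightarrow> \<theta>0"
proof -
  have "(\<lambda>j. 1 / s j) \<longlonglongrightarrow> 0"
    using scale unfolding s_def by (intro tendsto_divide_0[OF tendsto_const] filterlim_at_top_imp_at_infinity)
  then have "(\<lambda>j. \<theta>0 + (1 / s j) *\<^sub>R h) \<longlonglongrightarrow> \<theta>0 + 0 *\<^sub>R h"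
    by (intro tendsto_intros)
  then show ?thesis by (simp add: loc_def)
qed

lemma V_centre: "(\<lambda>j. V *v d j) \<longlonglongrightarrow> 0"
  using bounded_linear.tendsto[OF matrix_vector_mul_bounded_linear[of V] centre] by (simp add: d_def)

text \<open>
  The exponent enters only through its ratio to \<open>\<alpha>\<close>. Hence the quadratic expansion of the
  log-likelihood at the scale \<open>\<alpha>\<close> determines the local behaviour of the kernel at any exponent of
  the same order.
\<close>

lemma local_kernel_eq_exp:
  assumes "loc j h \<in> \<Theta>" "norm h \<le> real (Suc j)"
  shows "w e j h = exp (e j / \<alpha> (n j) * llr j h) * (prior (loc j h) / prior \<theta>0)"
  using assms(1) lik_pos[OF assms(2)] \<alpha>_pos[of j] prior0_pos
  by (simp add: local_kernel_def posterior_kernel_def loc_def[symmetric] llr_def powr_def exp_diff right_diff_distrib)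

lemma eventually_norm_le_Suc: "\<forall>\<^sub>F j in sequentially. r \<le> real (Suc j)"
  using eventually_ge_at_top[of "nat \<lceil>r\<rceil>"] by eventually_elim linarith

text \<open>
  The linear term of the expansion disappears because the rescaled estimator \<open>d j\<close> tends to \<open>0\<close>;
  this is the effect of tempering, since the untempered deviation is of order one.
\<close>

lemma llr_tendsto: "(\<lambda>j. llr j h) \<longlonglongrightarrow> - (h \<bullet> (V *v h)) / 2"
proof -
  have "(\<lambda>j. llr j h - h \<bullet> (V *v d j) + (h \<bullet> (V *v h)) / 2) \<longlonglongrightarrow> 0"
    using eventually_norm_le_Suc[of "norm h"]
    by (intro Lim_null_comparison[OF _ LIMSEQ_inverse_real_of_nat])
       (auto elim!: eventually_mono dest!: lik_pos(3) simp: inverse_eq_divide simp del: of_nat_Suc)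
  from tendsto_add[OF this tendsto_diff[OF tendsto_inner[OF tendsto_const[of h] V_centre] tendsto_const[of "(h \<bullet> (V *v h)) / 2"]]]
  show ?thesis by simp
qed

lemma local_kernel_tendsto:
  assumes e: "(\<lambda>j. e j / \<alpha> (n j)) \<longlonglongrightarrow> 1"
  shows "(\<lambda>j. w e j h) \<longlonglongrightarrow> gauss_kernel V h"
proof -
  have "(\<lambda>j. prior (loc j h)) \<longlonglongrightarrow> prior \<theta>0"
    by (rule isCont_tendsto_compose[OF prior_continuous loc_tendsto])
  then have "(\<lambda>j. exp (e j / \<alpha> (n j) * llr j h) * (prior (loc j h) / prior \<theta>0))
      \<longlonglongrightarrow> exp (1 * (- (h \<bullet> (V *v h)) / 2)) * (prior \<theta>0 / prior \<theta>0)"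
    using prior0_pos by (intro tendsto_intros e llr_tendsto) auto
  then have lim: "(\<lambda>j. exp (e j / \<alpha> (n j) * llr j h) * (prior (loc j h) / prior \<theta>0)) \<longlonglongrightarrow> gauss_kernel V h"
    using prior0_pos by (simp add: gauss_kernel_def)
  have "\<forall>\<^sub>F j in sequentially. exp (e j / \<alpha> (n j) * llr j h) * (prior (loc j h) / prior \<theta>0) = w e j h"
    using eventually_norm_le_Suc[of "norm h"] loc_near[of "norm h"]
    by eventually_elim (simp add: local_kernel_eq_exp)
  then show ?thesis
    using lim by (rule Lim_transform_eventually[rotated])
qed

lemma local_kernel_bounded:
  assumes e: "\<forall>\<^sub>F j in sequentially. 0 \<le> e j / \<alpha> (n j) \<and> e j / \<alpha> (n j) \<le> 2"
  shows "\<forall>\<^sub>F j in sequentially. \<forall>h\<in>cball 0 r. w e j h \<le> 2 * exp (2 * (1 + r))"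
proof -
  have "\<forall>\<^sub>F j in sequentially. norm (V *v d j) < 1"
    using V_centre by (intro order_tendstoD(2)[OF tendsto_norm_zero]) auto
  then show ?thesis
    using e loc_near[of r] eventually_norm_le_Suc[of r]
  proof eventually_elim
    case (elim j)
    show ?case
    proof
      fix h :: "real^'p" assume "h \<in> cball 0 r"
      then have h: "norm h \<le> r" "norm h \<le> real (Suc j)" and loc: "loc j h \<in> \<Theta>" "prior (loc j h) \<le> 2 * prior \<theta>0"
        using elim by auto
      have "r \<ge> 0" using h(1) norm_ge_zero[of h] by linarith
      have "h \<bullet> (V *v d j) \<le> norm h * norm (V *v d j)" by (rule norm_cauchy_schwarz)
      also have "\<dots> \<le> r * 1" using h elim \<open>r \<ge> 0\<close> by (intro mult_mono) auto
      finally have "h \<bullet> (V *v d j) \<le> r" by simp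
      moreover have "h \<bullet> (V *v h) \<ge> 0"
        using V by (cases "h = 0") (auto simp: pos_def_matrix_def less_imp_le)
      moreover have "1 / real (Suc j) \<le> 1" by simp
      ultimately have "llr j h \<le> 1 + r"
        using lik_pos(3)[OF h(2)] by linarith
      then have "e j / \<alpha> (n j) * llr j h \<le> e j / \<alpha> (n j) * (1 + r)"
        using elim by (intro mult_left_mono) auto
      also have "\<dots> \<le> 2 * (1 + r)"
        using elim \<open>r \<ge> 0\<close> by (intro mult_right_mono) auto
      finally have "exp (e j / \<alpha> (n j) * llr j h) * (prior (loc j h) / prior \<theta>0) \<le> exp (2 * (1 + r)) * 2"
        using prior0_pos loc prior_nonneg[OF loc(1)] by (intro mult_mono) (auto simp: field_simps)
      then show "w e j h \<le> 2 * exp (2 * (1 + r))"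
        using local_kernel_eq_exp[OF loc(1) h(2), of e] by simp
    qed
  qed
qed

text \<open>
  The moment assumption, which concerns the normalised posterior, in unnormalised form. The
  coordinate belonging to the exponent \<open>c \<alpha>\<close> differs from \<open>h\<close> by the factor \<open>sqrt c\<close>.
\<close>

lemma local_kernel_moment_bounded:
  assumes c: "c \<in> {1/2, 2}"
  shows "\<exists>K<\<infinity>. \<forall>\<^sub>F j in sequentially.
    (\<integral>\<^sup>+h. ennreal (norm h ^ Suc k * w (\<lambda>j. c * \<alpha> (n j)) j h) \<partial>lborel) \<le> K"
proof -
  define M' where "M' = M / sqrt c ^ Suc k"
  have c0: "c > 0" using c by auto
  have M': "M' \<ge> 0" using M c0 by (simp add: M'_def)
  define r where "r = max 1 (2 * M')"
  define B where "B = 2 * exp (2 * (1 + r))"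
  have "\<forall>\<^sub>F j in sequentially. \<forall>h\<in>cball 0 r. w (\<lambda>j. c * \<alpha> (n j)) j h \<le> B"
    unfolding B_def using c \<alpha>_pos
    by (intro local_kernel_bounded always_eventually) (auto simp: less_imp_le less_imp_neq[symmetric])
  then have "\<forall>\<^sub>F j in sequentially. (\<integral>\<^sup>+h. ennreal (norm h ^ Suc k * w (\<lambda>j. c * \<alpha> (n j)) j h) \<partial>lborel)
      \<le> ennreal (M' * (2 * B * measure lborel (cball (0 :: real^'p) r)))"
  proof eventually_elim
    case (elim j)
    interpret L: localization f \<Theta> prior \<theta>0 "s j" "n j" "x j" "c * \<alpha> (n j)"
      by (rule localization[OF proper'[OF c]])
    have "sqrt (c * \<alpha> (n j) * real (n j)) = sqrt c * s j"
      by (simp add: s_def real_sqrt_mult)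
    then have "(\<integral>\<^sup>+\<theta>. ennreal (norm ((sqrt c * s j) *\<^sub>R (\<theta> - \<theta>0)) ^ Suc k *
        posterior f \<Theta> prior (n j) (c * \<alpha> (n j)) (x j) \<theta>) \<partial>lborel) \<le> ennreal M"
      using moments[OF c, of j] by (simp only: powr_realpow'[OF norm_ge_zero nat.distinct(2)])
    then have "(\<integral>\<^sup>+h. ennreal (norm h ^ Suc k * L.w h) \<partial>lborel) \<le> ennreal (M' * integral\<^sup>L lborel L.w)"
      unfolding M'_def using M c0 by (intro L.moment_local) auto
    then show ?case
      using M' elim
      by (intro moment_bound_from_ratio[OF L.local_kernel_integrable L.local_kernel_nonneg])
         (auto simp: r_def)
  qed
  then show ?thesis by (intro exI[of _ "ennreal (M' * (2 * B * measure lborel (cball (0 :: real^'p) r)))"]) auto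
qed

lemma local_kernel_le_neighbours:
  assumes "\<alpha> (n j) / 2 \<le> b j" "b j \<le> 2 * \<alpha> (n j)"
  shows "w b j h \<le> w (\<lambda>j. 1/2 * \<alpha> (n j)) j h + w (\<lambda>j. 2 * \<alpha> (n j)) j h"
proof (cases "loc j h \<in> \<Theta>")
  case True
  define t where "t = f (n j) (loc j h) (x j) / f (n j) \<theta>0 (x j)"
  have t: "t \<ge> 0" using f_nonneg[OF True] f0_pos by (simp add: t_def less_imp_le)
  have "local_kernel f \<Theta> prior \<theta>0 (s j) (n j) e (x j) h = t powr e * (prior (loc j h) / prior \<theta>0)" for e
    using True f_nonneg[OF True] f0_pos[of j]
    by (simp add: local_kernel_def posterior_kernel_def loc_def[symmetric] t_def powr_divide)
  moreover have "t powr b j \<le> t powr (1/2 * \<alpha> (n j)) + t powr (2 * \<alpha> (n j))"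
    using t assms by (intro powr_le_sum_powr) auto
  then have "t powr b j * (prior (loc j h) / prior \<theta>0)
      \<le> (t powr (1/2 * \<alpha> (n j)) + t powr (2 * \<alpha> (n j))) * (prior (loc j h) / prior \<theta>0)"
    using prior_nonneg[OF True] prior0_pos by (intro mult_right_mono) auto
  ultimately show ?thesis by (simp only: distrib_right)
qed (simp add: local_kernel_def posterior_kernel_def loc_def[symmetric])

lemma posterior_tendsto_gauss:
  "(\<lambda>j. \<integral>\<^sup>+\<theta>. ennreal (norm (sqrt (\<alpha> (n j) * real (n j)) *\<^sub>R (\<theta> - \<theta>0)) ^ k *
      \<bar>posterior f \<Theta> prior (n j) (b j) (x j) \<theta>
        - mvn_density (\<theta>hat (n j) (x j)) ((1 / (\<alpha> (n j) * real (n j))) *\<^sub>R matrix_inv V) \<theta>\<bar>) \<partial>lborel) \<longlonglongrightarrow> 0"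
proof -
  have loc: "localization f \<Theta> prior \<theta>0 (s j) (n j) (x j) (b j)" for j
    by (rule localization[OF proper])
  have "\<forall>\<^sub>F j in sequentially. b j / \<alpha> (n j) > 1/2" "\<forall>\<^sub>F j in sequentially. b j / \<alpha> (n j) < 2"
    by (rule order_tendstoD[OF ratio], simp)+
  then have ev: "\<forall>\<^sub>F j in sequentially. 1/2 \<le> b j / \<alpha> (n j) \<and> b j / \<alpha> (n j) \<le> 2"
    by eventually_elim auto
  have bdd: "\<exists>B. \<forall>\<^sub>F j in sequentially. \<forall>h\<in>cball 0 r. w b j h \<le> B" for r
  proof (rule exI, rule local_kernel_bounded)
    show "\<forall>\<^sub>F j in sequentially. 0 \<le> b j / \<alpha> (n j) \<and> b j / \<alpha> (n j) \<le> 2"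
      using ev by eventually_elim linarith
  qed
  obtain K1 K2 where K: "K1 < \<infinity>" "K2 < \<infinity>"
    and K1: "\<forall>\<^sub>F j in sequentially. (\<integral>\<^sup>+h. ennreal (norm h ^ Suc k * w (\<lambda>j. 1/2 * \<alpha> (n j)) j h) \<partial>lborel) \<le> K1"
    and K2: "\<forall>\<^sub>F j in sequentially. (\<integral>\<^sup>+h. ennreal (norm h ^ Suc k * w (\<lambda>j. 2 * \<alpha> (n j)) j h) \<partial>lborel) \<le> K2"
    using local_kernel_moment_bounded[of "1/2"] local_kernel_moment_bounded[of 2] by auto
  have mom: "\<forall>\<^sub>F j in sequentially. (\<integral>\<^sup>+h. ennreal (norm h ^ Suc k * w b j h) \<partial>lborel) \<le> K1 + K2"
    using ev K1 K2
  proof eventually_elim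
    case (elim j)
    interpret L1: localization f \<Theta> prior \<theta>0 "s j" "n j" "x j" "1/2 * \<alpha> (n j)"
      by (rule localization[OF proper']) simp
    interpret L2: localization f \<Theta> prior \<theta>0 "s j" "n j" "x j" "2 * \<alpha> (n j)"
      by (rule localization[OF proper']) simp
    have le: "w b j h \<le> L1.w h + L2.w h" for h
      using elim \<alpha>_pos[of j] by (intro local_kernel_le_neighbours) (auto simp: field_simps)
    have "(\<integral>\<^sup>+h. ennreal (norm h ^ Suc k * w b j h) \<partial>lborel)
        \<le> (\<integral>\<^sup>+h. ennreal (norm h ^ Suc k * L1.w h) + ennreal (norm h ^ Suc k * L2.w h) \<partial>lborel)"
    proof (rule nn_integral_mono)
      fix h
      have "norm h ^ Suc k * w b j h \<le> norm h ^ Suc k * L1.w h + norm h ^ Suc k * L2.w h"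
        unfolding distrib_left[symmetric] by (intro mult_left_mono le) simp
      then have "ennreal (norm h ^ Suc k * w b j h) \<le> ennreal (norm h ^ Suc k * L1.w h + norm h ^ Suc k * L2.w h)"
        by (rule ennreal_leI)
      also have "\<dots> = ennreal (norm h ^ Suc k * L1.w h) + ennreal (norm h ^ Suc k * L2.w h)"
        by (intro ennreal_plus mult_nonneg_nonneg zero_le_power norm_ge_zero L1.local_kernel_nonneg L2.local_kernel_nonneg)
      finally show "ennreal (norm h ^ Suc k * w b j h) \<le> ennreal (norm h ^ Suc k * L1.w h) + ennreal (norm h ^ Suc k * L2.w h)" .
    qed
    also have "\<dots> = (\<integral>\<^sup>+h. ennreal (norm h ^ Suc k * L1.w h) \<partial>lborel) + (\<integral>\<^sup>+h. ennreal (norm h ^ Suc k * L2.w h) \<partial>lborel)"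
      by (rule nn_integral_add) measurable
    also have "\<dots> \<le> K1 + K2" using elim by (intro add_mono) auto
    finally show ?case .
  qed
  have "(\<lambda>j. \<integral>\<^sup>+h. ennreal (norm h ^ k * \<bar>w b j h / integral\<^sup>L lborel (w b j)
      - gauss_kernel V (h - d j) / integral\<^sup>L lborel (gauss_kernel V)\<bar>) \<partial>lborel) \<longlonglongrightarrow> 0"
    using centre K
    by (intro normalized_tendsto_gauss[OF V _ localization.local_kernel_measurable[OF loc]
          localization.local_kernel_nonneg[OF loc] localization.local_kernel_integrable[OF loc]
          local_kernel_tendsto[OF ratio] bdd mom]) (auto simp: d_def[abs_def])
  moreover have "(s j)\<^sup>2 = \<alpha> (n j) * real (n j)" for j
    using \<alpha>_pos[of j] by (simp add: s_def less_imp_le)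
  ultimately show ?thesis
    using localization.posterior_mvn_distance_local[OF loc V, where k = k] by (simp only: d_eq s_def[symmetric])
qed

end

section \<open>Convergence in outer probability\<close>

lemma outer_measure_of_Un_le:
  assumes "A \<subseteq> space M" "B \<subseteq> space M"
  shows "outer_measure_of M (A \<union> B) \<le> outer_measure_of M A + outer_measure_of M B"
proof -
  obtain E F where E: "E \<in> sets M" "A \<subseteq> E" "outer_measure_of M A = emeasure M E"
    and F: "F \<in> sets M" "B \<subseteq> F" "outer_measure_of M B = emeasure M F"
    using outer_measure_of_attain assms by metis
  have "outer_measure_of M (A \<union> B) \<le> outer_measure_of M (E \<union> F)"
    using E F by (intro outer_measure_of_mono) auto
  also have "\<dots> \<le> emeasure M E + emeasure M F"
    using E F by (simp add: emeasure_subadditive)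
  finally show ?thesis using E F by simp
qed

lemma outer_measure_of_AE:
  assumes "AE x in M. Q x"
  shows "outer_measure_of M {x \<in> space M. \<not> Q x} = 0"
proof -
  obtain N where "{x \<in> space M. \<not> Q x} \<subseteq> N" "emeasure M N = 0" "N \<in> sets M"
    using assms by (rule AE_E)
  then show ?thesis
    using outer_measure_of_mono[of "{x \<in> space M. \<not> Q x}" N M] by simp
qed

lemma with_prob_tending_to_1_conj:
  assumes "with_prob_tending_to_1 P E" "with_prob_tending_to_1 P F"
  shows "with_prob_tending_to_1 P (\<lambda>n x. E n x \<and> F n x)"
  unfolding with_prob_tending_to_1_def
proof (rule tendsto_sandwich[OF _ _ tendsto_const])
  show "\<forall>\<^sub>F n in sequentially. outer_measure_of (P n) {x \<in> space (P n). \<not> (E n x \<and> F n x)}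
      \<le> outer_measure_of (P n) {x \<in> space (P n). \<not> E n x} + outer_measure_of (P n) {x \<in> space (P n). \<not> F n x}"
  proof (rule always_eventually, rule allI)
    fix n
    have "{x \<in> space (P n). \<not> (E n x \<and> F n x)} = {x \<in> space (P n). \<not> E n x} \<union> {x \<in> space (P n). \<not> F n x}"
      by auto
    then show "outer_measure_of (P n) {x \<in> space (P n). \<not> (E n x \<and> F n x)}
      \<le> outer_measure_of (P n) {x \<in> space (P n). \<not> E n x} + outer_measure_of (P n) {x \<in> space (P n). \<not> F n x}"
      using outer_measure_of_Un_le[of "{x \<in> space (P n). \<not> E n x}" "P n" "{x \<in> space (P n). \<not> F n x}"] by simp
  qed
  show "(\<lambda>n. outer_measure_of (P n) {x \<in> space (P n). \<not> E n x} + outer_measure_of (P n) {x \<in> space (P n). \<not> F n x}) \<longlonglongrightarrow> 0"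
    using tendsto_add[OF assms[unfolded with_prob_tending_to_1_def]] by simp
qed simp

lemma with_prob_tending_to_1_AE:
  assumes "\<forall>\<^sub>F n in sequentially. AE x in P n. E n x"
  shows "with_prob_tending_to_1 P E"
  unfolding with_prob_tending_to_1_def
  by (rule tendsto_eventually, rule eventually_mono[OF assms outer_measure_of_AE])

lemma with_prob_tending_to_1_tendsto_0:
  assumes "tendsto_0_in_prob P Z" "\<epsilon> > 0"
  shows "with_prob_tending_to_1 P (\<lambda>n x. Z n x \<le> ennreal \<epsilon>)"
  using assms by (simp add: tendsto_0_in_prob_def with_prob_tending_to_1_def not_le)

text \<open>
  A sequence that converges in law is tight, and a tight sequence multiplied by a null sequence
  vanishes in probability. The tail beyond \<open>K + 1\<close> is compared with a continuous function that vanishes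
  up to \<open>K\<close>, since convergence in law is tested on continuous functions.
\<close>

lemma asymptotically_normal_scaled:
  fixes Z :: "nat \<Rightarrow> 'a \<Rightarrow> real^'p"
  assumes Z: "asymptotically_normal P Z" and P: "\<And>n. n \<ge> 1 \<Longrightarrow> prob_space (P n)"
    and meas: "\<And>n. n \<ge> 1 \<Longrightarrow> Z n \<in> borel_measurable (P n)"
    and c: "c \<longlonglongrightarrow> 0" and \<epsilon>: "\<epsilon> > 0"
  shows "with_prob_tending_to_1 P (\<lambda>n x. norm (c n *\<^sub>R Z n x) \<le> \<epsilon>)"
proof -
  obtain m :: "real^'p" and A :: "real^'p^'p" where lim: "\<And>g :: real^'p \<Rightarrow> real.
      continuous_on UNIV g \<Longrightarrow> bounded (range g) \<Longrightarrow> (\<lambda>n. LINT x|P n. g (Z n x)) \<longlonglongrightarrow>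
          (LINT z|lborel. mvn_density 0 (mat 1) z * g (m + A *v z))"
    using Z by (auto simp: asymptotically_normal_def)
  define q where "q = (mvn_density 0 (mat 1) :: real^'p \<Rightarrow> real)"
  have pd: "pos_def_matrix (mat 1 :: real^'p^'p)" by (simp add: pos_def_mat)
  have "q = (\<lambda>h. gauss_kernel (mat 1) h / integral\<^sup>L lborel (gauss_kernel (mat 1 :: real^'p^'p)))"
  proof
    fix h
    show "q h = gauss_kernel (mat 1) h / integral\<^sup>L lborel (gauss_kernel (mat 1 :: real^'p^'p))"
      using mvn_density_local_coordinates[OF pd, of 1 0 0 h] matrix_inv_eqI[of "mat 1 :: real^'p^'p" "mat 1"]
      by (simp add: q_def)
  qed
  then have q: "integrable lborel q" "\<And>h. q h \<ge> 0"
    using integrable_gauss_kernel[OF pd] integral_gauss_kernel(2)[OF pd]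
    by (auto simp: gauss_kernel_pos less_imp_le simp flip: fun_eq_iff)
  have [measurable]: "q \<in> borel_measurable borel" using borel_measurable_integrable[OF q(1)] by simp
  have [measurable]: "(*v) A \<in> borel_measurable borel"
    by (intro borel_measurable_continuous_onI matrix_vector_mult_linear_continuous_on)
  define g where "g = (\<lambda>(K::nat) (z::real^'p). min 1 (max 0 (norm z - real K)))"
  have g: "0 \<le> g K z" "g K z \<le> 1" for K z by (auto simp: g_def)
  have gcont: "continuous_on UNIV (g K)" for K unfolding g_def by (intro continuous_intros)
  have gb: "bounded (range (g K))" for K
    using g by (intro boundedI[of _ 1]) auto
  have [measurable]: "g K \<in> borel_measurable borel" for K
    by (intro borel_measurable_continuous_onI gcont)
  have "(\<lambda>K. LINT z|lborel. q z * g K (m + A *v z)) \<longlonglongrightarrow> (LINT z|(lborel :: (real^'p) measure). 0 :: real)"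
  proof (rule integral_dominated_convergence[where w = q])
    show "AE z in lborel. (\<lambda>K. q z * g K (m + A *v z)) \<longlonglongrightarrow> 0"
    proof (rule AE_I2, rule tendsto_eventually)
      fix z :: "real^'p"
      show "\<forall>\<^sub>F K in sequentially. q z * g K (m + A *v z) = 0"
        using eventually_ge_at_top[of "nat \<lceil>norm (m + A *v z)\<rceil>"]
      proof eventually_elim
        case (elim K)
        then have "norm (m + A *v z) \<le> real K" by linarith
        then show ?case by (simp add: g_def)
      qed
    qed
    show "AE z in lborel. norm (q z * g K (m + A *v z)) \<le> q z" for K
      using q(2) g by (intro AE_I2) (auto simp: abs_mult intro: mult_left_le)
  qed (use q in auto)
  then have tail: "(\<lambda>K. LINT z|lborel. q z * g K (m + A *v z)) \<longlonglongrightarrow> 0" by simp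
  show ?thesis
    unfolding with_prob_tending_to_1_def
  proof (rule tendsto_zero_ennreal)
    fix \<delta> :: real assume \<delta>: "0 < \<delta>"
    obtain K where K: "(LINT z|lborel. q z * g K (m + A *v z)) < \<delta>"
      using order_tendstoD(2)[OF tail \<delta>] eventually_happens'[OF sequentially_bot] by blast
    have "\<forall>\<^sub>F n in sequentially. (LINT x|P n. g K (Z n x)) < \<delta>"
      by (rule order_tendstoD(2)[OF lim[OF gcont gb]]) (use K in \<open>simp add: q_def\<close>)
    moreover have "\<forall>\<^sub>F n in sequentially. \<bar>c n\<bar> < \<epsilon> / (real K + 1)"
      using order_tendstoD(2)[OF tendsto_rabs_zero[OF c], of "\<epsilon> / (real K + 1)"] \<epsilon> by simp
    ultimately show "\<forall>\<^sub>F n in sequentially. outer_measure_of (P n) {x \<in> space (P n). \<not> norm (c n *\<^sub>R Z n x) \<le> \<epsilon>} < ennreal \<delta>"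
      using eventually_ge_at_top[of 1]
    proof eventually_elim
      case (elim n)
      interpret prob_space "P n" using P elim by simp
      note [measurable] = meas[OF elim(3)]
      define S where "S = {x \<in> space (P n). norm (Z n x) > real K + 1}"
      have S [measurable]: "S \<in> sets (P n)" unfolding S_def by measurable
      have "{x \<in> space (P n). \<not> norm (c n *\<^sub>R Z n x) \<le> \<epsilon>} \<subseteq> S"
      proof
        fix x assume x: "x \<in> {x \<in> space (P n). \<not> norm (c n *\<^sub>R Z n x) \<le> \<epsilon>}"
        have "norm (Z n x) > real K + 1"
        proof (rule ccontr)
          assume "\<not> norm (Z n x) > real K + 1"
          then have "\<bar>c n\<bar> * norm (Z n x) \<le> \<epsilon> / (real K + 1) * (real K + 1)"
            using elim \<epsilon> by (intro mult_mono) auto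
          then show False using x by simp
        qed
        then show "x \<in> S" using x by (simp add: S_def)
      qed
      then have "outer_measure_of (P n) {x \<in> space (P n). \<not> norm (c n *\<^sub>R Z n x) \<le> \<epsilon>} \<le> emeasure (P n) S"
        unfolding outer_measure_of_eq[OF S, symmetric] by (rule outer_measure_of_mono)
      also have "\<dots> = ennreal (LINT x|P n. indicator S x)"
        by (simp add: emeasure_eq_measure)
      also have "\<dots> \<le> ennreal (LINT x|P n. g K (Z n x))"
      proof (intro ennreal_leI integral_mono)
        show "integrable (P n) (\<lambda>x. g K (Z n x))"
          using g by (intro integrable_const_bound[of _ 1]) auto
        show "indicator S x \<le> g K (Z n x)" if "x \<in> space (P n)" for x
          using g by (auto simp: S_def g_def indicator_def)
      qed (auto intro!: integrable_real_indicator S simp: less_top[symmetric])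
      also have "\<dots> < ennreal \<delta>" using elim \<delta> by (intro ennreal_lessI) auto
      finally show ?case .
    qed
  qed
qed

section \<open>Convergence of the posteriors\<close>

lemma tempering_seq_scale_at_top:
  assumes "tempering_seq \<alpha>"
  shows "filterlim (\<lambda>n. \<alpha> n * real n) at_top sequentially"
proof -
  have "filterlim (\<lambda>n. inverse ((1 / real n) / \<alpha> n)) at_top sequentially"
  proof (rule filterlim_inverse_at_top)
    show "(\<lambda>n. 1 / real n / \<alpha> n) \<longlonglongrightarrow> 0" using assms by (simp add: tempering_seq_def)
    show "\<forall>\<^sub>F n in sequentially. 0 < 1 / real n / \<alpha> n"
      using eventually_ge_at_top[of 1] by eventually_elim (use assms in \<open>auto simp: tempering_seq_def\<close>)
  qed
  then show ?thesis by (simp add: mult.commute)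
qed

lemma tempering_seq_cmult:
  assumes "tempering_seq \<alpha>" "c > 0"
  shows "tempering_seq (\<lambda>n. c * \<alpha> n)"
proof -
  have "(\<lambda>n. (1 / c) * (1 / real n / \<alpha> n)) \<longlonglongrightarrow> (1 / c) * 0" "(\<lambda>n. c * (\<alpha> n / 1)) \<longlonglongrightarrow> c * 0"
    using assms(1) by (intro tendsto_mult_left; simp add: tempering_seq_def)+
  then show ?thesis using assms by (simp add: tempering_seq_def mult_ac)
qed

lemma parametric_modelD:
  assumes "parametric_model \<X> \<nu> f0 f \<Theta> prior" "n \<ge> 1"
  shows "prob_space (data_law \<nu> f0 n)"
    "\<And>\<theta> x. \<theta> \<in> \<Theta> \<Longrightarrow> x \<in> space (data_law \<nu> f0 n) \<Longrightarrow> f n \<theta> x \<ge> 0"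
    "\<And>e x. open \<Theta> \<Longrightarrow> x \<in> space (data_law \<nu> f0 n) \<Longrightarrow> posterior_kernel f \<Theta> prior n e x \<in> borel_measurable borel"
proof -
  have dens: "is_density (sample_measure \<nu> n) (f0 n)" "\<And>\<theta>. \<theta> \<in> \<Theta> \<Longrightarrow> is_density (sample_measure \<nu> n) (f n \<theta>)"
    using assms by (auto simp: parametric_model_def)
  have sp: "space (data_law \<nu> f0 n) = space (sample_measure \<nu> n)" by (simp add: data_law_def)
  show "prob_space (data_law \<nu> f0 n)"
    using dens(1) unfolding data_law_def is_density_def
    by (intro prob_spaceI) (simp add: emeasure_density cong: nn_integral_cong)
  show "f n \<theta> x \<ge> 0" if "\<theta> \<in> \<Theta>" "x \<in> space (data_law \<nu> f0 n)" for \<theta> x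
    using dens(2)[OF that(1)] that(2) by (simp add: is_density_def sp)
  fix e x assume "open \<Theta>" and x: "x \<in> space (data_law \<nu> f0 n)"
  have "(\<lambda>(\<theta>, x). f n \<theta> x) \<in> borel_measurable (restrict_space borel \<Theta> \<Otimes>\<^sub>M sample_measure \<nu> n)"
    and prior: "prior \<in> borel_measurable (restrict_space borel \<Theta>)"
    using assms by (auto simp: parametric_model_def)
  then have "(\<lambda>\<theta>. f n \<theta> x) \<in> borel_measurable (restrict_space borel \<Theta>)"
    using measurable_compose[OF measurable_Pair2'[of x "sample_measure \<nu> n" "restrict_space borel \<Theta>"]] x
    by (force simp: sp)
  with prior have "(\<lambda>\<theta>. f n \<theta> x powr e * prior \<theta>) \<in> borel_measurable (restrict_space borel \<Theta>)"
    by measurable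
  then show "posterior_kernel f \<Theta> prior n e x \<in> borel_measurable borel"
    using \<open>open \<Theta>\<close> by (subst (asm) borel_measurable_restrict_space_iff) (auto simp: posterior_kernel_def[abs_def])
qed

text \<open>
  Both convergences of the theorem in one statement: the deterministic exponent is the constant
  \<open>\<alpha>hat n x = \<alpha> n\<close>. The event \<open>good m\<close> collects, with tolerance \<open>1 / Suc m\<close>, everything that holds with
  probability tending to one. The posterior moments \<open>mo c n x\<close> are only tight: for each probability
  level they stay below some \<open>M\<close>. If, for such an \<open>M\<close>, no tolerance were sufficient for the distance to
  be at most \<open>\<epsilon>\<close>, one counterexample for each \<open>m\<close> would form a sequence of good samples along which the
  distance tends to zero, a contradiction.
\<close>

lemma alpha_posterior_tendsto_gauss:
  fixes f :: "nat \<Rightarrow> real^'p \<Rightarrow> (nat \<Rightarrow> real^'d) \<Rightarrow> real"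
  assumes model: "parametric_model \<X> \<nu> f0 f \<Theta> prior"
    and A0: "assumption_A0 (data_law \<nu> f0) f \<Theta> \<theta>hat \<theta>star"
    and A1: "assumption_A1 prior \<theta>star"
    and A2: "assumption_A2 (data_law \<nu> f0) f \<theta>hat \<theta>star V"
    and A3: "assumption_A3 (data_law \<nu> f0) f \<Theta> prior \<theta>star"
    and \<alpha>: "tempering_seq \<alpha>"
    and proper: "\<And>n. n \<ge> 1 \<Longrightarrow> AE x in data_law \<nu> f0 n. proper_posterior f \<Theta> prior n (\<alpha>hat n x) x"
    and ratio: "tendsto_0_in_prob (data_law \<nu> f0) (\<lambda>n x. ennreal \<bar>\<alpha>hat n x / \<alpha> n - 1\<bar>)"
  shows "tendsto_0_in_prob (data_law \<nu> f0) (\<lambda>n x.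
          \<integral>\<^sup>+\<theta>. ennreal (norm (sqrt (\<alpha> n * real n) *\<^sub>R (\<theta> - \<theta>star)) ^ k *
            \<bar>posterior f \<Theta> prior n (\<alpha>hat n x) x \<theta>
              - mvn_density (\<theta>hat n x) ((1 / (\<alpha> n * real n)) *\<^sub>R matrix_inv V) \<theta>\<bar>) \<partial>lborel)"
    (is "tendsto_0_in_prob ?P ?I")
  unfolding tendsto_0_in_prob_def
proof (intro allI impI)
  fix \<epsilon> :: real assume \<epsilon>: "\<epsilon> > 0"
  define mo where "mo = (\<lambda>c n x. \<integral>\<^sup>+\<theta>. ennreal (norm (sqrt (c * \<alpha> n * real n) *\<^sub>R (\<theta> - \<theta>star)) powr real (Suc k) *
          posterior f \<Theta> prior n (c * \<alpha> n) x \<theta>) \<partial>lborel)"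
  define good where "good = (\<lambda>m n x. n \<ge> Suc m \<and> \<bar>\<alpha>hat n x / \<alpha> n - 1\<bar> \<le> 1 / real (Suc m)
    \<and> proper_posterior f \<Theta> prior n (\<alpha>hat n x) x
    \<and> proper_posterior f \<Theta> prior n (1/2 * \<alpha> n) x \<and> proper_posterior f \<Theta> prior n (2 * \<alpha> n) x
    \<and> norm (sqrt (\<alpha> n) *\<^sub>R \<Delta>\<^sub>n \<theta>hat \<theta>star n x) \<le> 1 / real (Suc m)
    \<and> (SUP h\<in>cball 0 (real (Suc m)). e2ennreal \<bar>lan_remainder f \<theta>hat \<theta>star V \<alpha> n x h\<bar>) \<le> ennreal (1 / real (Suc m)))"
  have \<alpha>_pos: "\<alpha> n > 0" if "n \<ge> 1" for n using \<alpha> that by (simp add: tempering_seq_def)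
  have open_\<Theta>: "open \<Theta>" and \<theta>star: "\<theta>star \<in> \<Theta>" using A0 by (auto simp: assumption_A0_def)
  have V: "pos_def_matrix V" using A2 by (simp add: assumption_A2_def)

  have good_prob: "with_prob_tending_to_1 ?P (good m)" for m
  proof -
    have m: "1 / real (Suc m) > 0" by simp
    have 1: "with_prob_tending_to_1 ?P (\<lambda>n x. \<bar>\<alpha>hat n x / \<alpha> n - 1\<bar> \<le> 1 / real (Suc m))"
      using with_prob_tending_to_1_tendsto_0[OF ratio m] by simp
    have 2: "with_prob_tending_to_1 ?P (\<lambda>n x. norm (sqrt (\<alpha> n) *\<^sub>R \<Delta>\<^sub>n \<theta>hat \<theta>star n x) \<le> 1 / real (Suc m))"
    proof (rule asymptotically_normal_scaled[OF _ _ _ _ m])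
      show "asymptotically_normal ?P (\<Delta>\<^sub>n \<theta>hat \<theta>star)" using A0 by (simp add: assumption_A0_def)
      show "prob_space (?P n)" if "n \<ge> 1" for n using parametric_modelD(1)[OF model that] .
      show "\<Delta>\<^sub>n \<theta>hat \<theta>star n \<in> borel_measurable (?P n)" if "n \<ge> 1" for n
        using A0 that unfolding assumption_A0_def \<Delta>\<^sub>n_def[abs_def] by (auto intro!: borel_measurable_scaleR borel_measurable_diff)
      have "(\<lambda>n. sqrt (\<alpha> n)) \<longlonglongrightarrow> sqrt 0"
        using \<alpha> by (intro tendsto_real_sqrt) (simp add: tempering_seq_def)
      then show "(\<lambda>n. sqrt (\<alpha> n)) \<longlonglongrightarrow> 0" by simp
    qed
    have "tendsto_0_in_prob ?P (\<lambda>n x. SUP h\<in>cball 0 (real (Suc m)). e2ennreal \<bar>lan_remainder f \<theta>hat \<theta>star V \<alpha> n x h\<bar>)"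
      using A2 \<alpha> unfolding assumption_A2_def by simp
    note 3 = with_prob_tending_to_1_tendsto_0[OF this m]
    have proper_fixed: "AE x in ?P n. proper_posterior f \<Theta> prior n a x" if "n \<ge> 1" "a > 0" for n a
      using model that by (simp add: parametric_model_def)
    have "\<forall>\<^sub>F n in sequentially. AE x in ?P n. n \<ge> Suc m \<and> proper_posterior f \<Theta> prior n (\<alpha>hat n x) x
      \<and> proper_posterior f \<Theta> prior n (1/2 * \<alpha> n) x \<and> proper_posterior f \<Theta> prior n (2 * \<alpha> n) x"
      using eventually_ge_at_top[of "Suc m"]
    proof eventually_elim
      case (elim n)
      then have "n \<ge> 1" by simp
      from proper[OF this] proper_fixed[OF this, of "1/2 * \<alpha> n"] proper_fixed[OF this, of "2 * \<alpha> n"] \<alpha>_pos[OF this] elim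
      show ?case by auto
    qed
    note 4 = with_prob_tending_to_1_AE[OF this]
    show ?thesis
      using with_prob_tending_to_1_conj[OF 1 with_prob_tending_to_1_conj[OF 2 with_prob_tending_to_1_conj[OF 3 4]]]
      unfolding good_def by (simp only: conj_ac)
  qed

  \<comment> \<open>Some tolerance suffices, uniformly in the sample size and the sample.\<close>
  have key: "\<exists>m. \<forall>n x. x \<in> space (?P n) \<longrightarrow> good m n x \<longrightarrow> mo (1/2) n x \<le> ennreal M \<longrightarrow> mo 2 n x \<le> ennreal M \<longrightarrow> ?I n x \<le> ennreal \<epsilon>"
    if M: "M \<ge> 0" for M
  proof (rule ccontr)
    assume no_m: "\<not> ?thesis"
    define Q where "Q = (\<lambda>m n x. x \<in> space (?P n) \<and> good m n x \<and> mo (1/2) n x \<le> ennreal M \<and> mo 2 n x \<le> ennreal M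
      \<and> \<not> ?I n x \<le> ennreal \<epsilon>)"
    have "\<forall>m. \<exists>n x. Q m n x" using no_m unfolding Q_def by (simp only: not_all not_ex not_imp simp_thms)
    then obtain N X where "\<And>j. Q j (N j) (X j)" by metis
    then have NX: "\<And>j. X j \<in> space (?P (N j))" "\<And>j. good j (N j) (X j)"
      "\<And>j. mo (1/2) (N j) (X j) \<le> ennreal M" "\<And>j. mo 2 (N j) (X j) \<le> ennreal M" "\<And>j. \<not> ?I (N j) (X j) \<le> ennreal \<epsilon>"
      unfolding Q_def by blast+
    have Nj: "N j \<ge> Suc j" "N j \<ge> 1" for j using NX(2)[of j] by (auto simp: good_def)
    have small: "(\<lambda>j. 1 / real (Suc j)) \<longlonglongrightarrow> 0"
      using LIMSEQ_inverse_real_of_nat by (simp add: inverse_eq_divide)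
    interpret good_samples f \<Theta> prior \<theta>hat \<theta>star V \<alpha> k M N X "\<lambda>j. \<alpha>hat (N j) (X j)"
    proof
      show "prior \<theta> \<ge> 0" if "\<theta> \<in> \<Theta>" for \<theta> using model that by (simp add: parametric_model_def)
      show "f (N j) \<theta> (X j) \<ge> 0" if "\<theta> \<in> \<Theta>" for j \<theta>
        by (rule parametric_modelD(2)[OF model Nj(2) that NX(1)])
      show "posterior_kernel f \<Theta> prior (N j) e (X j) \<in> borel_measurable borel" for j e
        by (rule parametric_modelD(3)[OF model Nj(2) open_\<Theta> NX(1)])
      \<comment> \<open>The sample sizes go to infinity since \<open>good j\<close> contains \<open>n \<ge> Suc j\<close>.\<close>
      have "filterlim N at_top sequentially"
        using Nj(1) by (intro filterlim_at_top_mono[OF filterlim_Suc]) auto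
      then have "filterlim (\<lambda>j. \<alpha> (N j) * real (N j)) at_top sequentially"
        by (rule filterlim_compose[OF tempering_seq_scale_at_top[OF \<alpha>]])
      then show "filterlim (\<lambda>j. sqrt (\<alpha> (N j) * real (N j))) at_top sequentially"
        by (rule filterlim_compose[OF sqrt_at_top])
      have "(\<lambda>j. \<alpha>hat (N j) (X j) / \<alpha> (N j) - 1) \<longlonglongrightarrow> 0"
        using NX(2) by (intro Lim_null_comparison[OF _ small]) (auto simp: good_def)
      then show "(\<lambda>j. \<alpha>hat (N j) (X j) / \<alpha> (N j)) \<longlonglongrightarrow> 1" by (rule LIM_zero_cancel)
      show "(\<lambda>j. sqrt (\<alpha> (N j)) *\<^sub>R \<Delta>\<^sub>n \<theta>hat \<theta>star (N j) (X j)) \<longlonglongrightarrow> 0"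
        using NX(2) unfolding good_def by (intro Lim_null_comparison[OF _ small] always_eventually) blast
      show "proper_posterior f \<Theta> prior (N j) (\<alpha>hat (N j) (X j)) (X j)" for j
        using NX(2)[of j] by (simp add: good_def)
      show "proper_posterior f \<Theta> prior (N j) (c * \<alpha> (N j)) (X j)" if "c \<in> {1/2, 2}" for c j
        using NX(2)[of j] that unfolding good_def by blast
      show "e2ennreal \<bar>lan_remainder f \<theta>hat \<theta>star V \<alpha> (N j) (X j) h\<bar> \<le> ennreal (1 / real (Suc j))"
        if "h \<in> cball 0 (real (Suc j))" for j h
      proof (rule order_trans[OF SUP_upper[OF that]])
        show "(SUP h\<in>cball 0 (real (Suc j)). e2ennreal \<bar>lan_remainder f \<theta>hat \<theta>star V \<alpha> (N j) (X j) h\<bar>)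
            \<le> ennreal (1 / real (Suc j))"
          using NX(2)[of j] unfolding good_def by blast
      qed
      show "(\<integral>\<^sup>+\<theta>. ennreal (norm (sqrt (c * \<alpha> (N j) * real (N j)) *\<^sub>R (\<theta> - \<theta>star)) powr real (Suc k) *
          posterior f \<Theta> prior (N j) (c * \<alpha> (N j)) (X j) \<theta>) \<partial>lborel) \<le> ennreal M" if "c \<in> {1/2, 2}" for c j
        using NX(3,4)[of j] that unfolding mo_def by blast
    qed (use V open_\<Theta> \<theta>star A1 \<alpha>_pos Nj M in auto)
    have "\<forall>\<^sub>F j in sequentially. ?I (N j) (X j) < ennreal \<epsilon>"
      using order_tendstoD(2)[OF posterior_tendsto_gauss] \<epsilon> by simp
    then obtain j where "?I (N j) (X j) < ennreal \<epsilon>"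
      using eventually_happens'[OF sequentially_bot] by blast
    with NX(5)[of j] show False by simp
  qed

  have mo_prob: "\<exists>M. \<forall>\<^sub>F n in sequentially. outer_measure_of (?P n) {x \<in> space (?P n). mo c n x > ennreal M} < ennreal \<delta>"
    if "c > 0" "\<delta> > 0" for c \<delta>
  proof -
    have t: "tempering_seq (\<lambda>n. c * \<alpha> n)" by (rule tempering_seq_cmult[OF \<alpha> \<open>c > 0\<close>])
    obtain M L where bound: "\<And>n. n \<ge> 1 \<Longrightarrow> c * \<alpha> n * real n \<ge> real L \<Longrightarrow>
        outer_measure_of (?P n) {x \<in> space (?P n). mo c n x > ennreal M} < ennreal \<delta>"
      using A3[unfolded assumption_A3_def, THEN spec, THEN mp, OF t, THEN spec, THEN mp, OF \<open>\<delta> > 0\<close>,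
          THEN spec, THEN mp, OF of_nat_0_le_iff, of "Suc k"]
      unfolding mo_def by blast
    have "\<forall>\<^sub>F n in sequentially. c * \<alpha> n * real n \<ge> real L"
      using tempering_seq_scale_at_top[OF t] by (simp add: filterlim_at_top)
    then have "\<forall>\<^sub>F n in sequentially. outer_measure_of (?P n) {x \<in> space (?P n). mo c n x > ennreal M} < ennreal \<delta>"
      using eventually_ge_at_top[of 1] by eventually_elim (rule bound)
    then show ?thesis by blast
  qed

  show "(\<lambda>n. outer_measure_of (?P n) {x \<in> space (?P n). ?I n x > ennreal \<epsilon>}) \<longlonglongrightarrow> 0"
  proof (rule tendsto_zero_ennreal)
    fix \<delta> :: real assume \<delta>: "0 < \<delta>"
    \<comment> \<open>Three exceptional events of outer probability below \<open>\<delta> / 4\<close> each.\<close>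
    obtain M1 where M1: "\<forall>\<^sub>F n in sequentially. outer_measure_of (?P n) {x \<in> space (?P n). mo (1/2) n x > ennreal M1} < ennreal (\<delta> / 4)"
      using mo_prob[of "1/2" "\<delta> / 4"] \<delta> by (meson half_gt_zero_iff zero_less_divide_iff zero_less_numeral zero_less_one)
    obtain M2 where M2: "\<forall>\<^sub>F n in sequentially. outer_measure_of (?P n) {x \<in> space (?P n). mo 2 n x > ennreal M2} < ennreal (\<delta> / 4)"
      using mo_prob[of 2 "\<delta> / 4"] \<delta> by (meson zero_less_divide_iff zero_less_numeral)
    define M where "M = max 0 (max M1 M2)"
    obtain m where m: "\<And>n x. x \<in> space (?P n) \<Longrightarrow> good m n x \<Longrightarrow> mo (1/2) n x \<le> ennreal M \<Longrightarrow> mo 2 n x \<le> ennreal M \<Longrightarrow> ?I n x \<le> ennreal \<epsilon>"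
    proof -
      have "M \<ge> 0" by (simp add: M_def)
      from key[OF this] show thesis using that by blast
    qed
    have "\<forall>\<^sub>F n in sequentially. outer_measure_of (?P n) {x \<in> space (?P n). \<not> good m n x} < ennreal (\<delta> / 4)"
      using good_prob[of m] \<delta> unfolding with_prob_tending_to_1_def by (intro order_tendstoD(2)) auto
    then show "\<forall>\<^sub>F n in sequentially. outer_measure_of (?P n) {x \<in> space (?P n). ?I n x > ennreal \<epsilon>} < ennreal \<delta>"
      using M1 M2
    proof eventually_elim
      case (elim n)
      let ?A = "{x \<in> space (?P n). \<not> good m n x}"
      let ?B1 = "{x \<in> space (?P n). mo (1/2) n x > ennreal M1}"
      let ?B2 = "{x \<in> space (?P n). mo 2 n x > ennreal M2}"
      have MM: "ennreal M1 \<le> ennreal M" "ennreal M2 \<le> ennreal M"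
        by (auto simp: M_def intro!: ennreal_leI)
      have "{x \<in> space (?P n). ?I n x > ennreal \<epsilon>} \<subseteq> ?A \<union> (?B1 \<union> ?B2)"
      proof
        fix x assume x: "x \<in> {x \<in> space (?P n). ?I n x > ennreal \<epsilon>}"
        show "x \<in> ?A \<union> (?B1 \<union> ?B2)"
        proof (rule ccontr)
          assume "x \<notin> ?A \<union> (?B1 \<union> ?B2)"
          then have "good m n x" "mo (1/2) n x \<le> ennreal M1" "mo 2 n x \<le> ennreal M2"
            using x by auto
          then have "?I n x \<le> ennreal \<epsilon>"
            using x MM by (intro m) (auto intro: order_trans)
          then show False using x by auto
        qed
      qed
      then have "outer_measure_of (?P n) {x \<in> space (?P n). ?I n x > ennreal \<epsilon>} \<le> outer_measure_of (?P n) (?A \<union> (?B1 \<union> ?B2))"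
        by (rule outer_measure_of_mono)
      also have "\<dots> \<le> outer_measure_of (?P n) ?A + outer_measure_of (?P n) (?B1 \<union> ?B2)"
        by (rule outer_measure_of_Un_le) auto
      also have "\<dots> \<le> outer_measure_of (?P n) ?A + (outer_measure_of (?P n) ?B1 + outer_measure_of (?P n) ?B2)"
        by (intro add_left_mono outer_measure_of_Un_le) auto
      also have "\<dots> \<le> ennreal (\<delta> / 4) + (ennreal (\<delta> / 4) + ennreal (\<delta> / 4))"
        using elim by (intro add_mono) auto
      also have "\<dots> = ennreal (\<delta> / 4 + (\<delta> / 4 + \<delta> / 4))"
        using \<delta> by (simp del: ennreal_plus add: ennreal_plus[symmetric])
      also have "\<dots> < ennreal \<delta>" using \<delta> by (intro ennreal_lessI) auto
      finally show ?case .
    qed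
  qed
qed

theorem theorem1:
  fixes \<X> :: "(real^'d) set" and \<nu> :: "(real^'d) measure"
    and f0 :: "nat \<Rightarrow> (nat \<Rightarrow> real^'d) \<Rightarrow> real"
    and f :: "nat \<Rightarrow> real^'p \<Rightarrow> (nat \<Rightarrow> real^'d) \<Rightarrow> real"
    and \<Theta> :: "(real^'p) set" and prior :: "real^'p \<Rightarrow> real"
    and \<theta>hat :: "nat \<Rightarrow> (nat \<Rightarrow> real^'d) \<Rightarrow> real^'p" and \<theta>star :: "real^'p" and V :: "real^'p^'p"
  assumes model: "parametric_model \<X> \<nu> f0 f \<Theta> prior"
    and A0: "assumption_A0 (data_law \<nu> f0) f \<Theta> \<theta>hat \<theta>star"
    and A1: "assumption_A1 prior \<theta>star"
    and A2: "assumption_A2 (data_law \<nu> f0) f \<theta>hat \<theta>star V"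
    and A3: "assumption_A3 (data_law \<nu> f0) f \<Theta> prior \<theta>star"
  shows
    "(\<forall>\<alpha> (k::nat). tempering_seq \<alpha> \<longrightarrow>
        tendsto_0_in_prob (data_law \<nu> f0) (\<lambda>n x.
          \<integral>\<^sup>+\<theta>. ennreal (norm (sqrt (\<alpha> n * real n) *\<^sub>R (\<theta> - \<theta>star)) ^ k *
            \<bar>posterior f \<Theta> prior n (\<alpha> n) x \<theta>
              - mvn_density (\<theta>hat n x) ((1 / (\<alpha> n * real n)) *\<^sub>R matrix_inv V) \<theta>\<bar>) \<partial>lborel))
     \<and>
     (\<forall>(\<alpha>hat :: nat \<Rightarrow> (nat \<Rightarrow> real^'d) \<Rightarrow> real) \<alpha> L c0 c1 c2 r \<gamma> \<kappa>.
        (\<forall>n\<ge>1. \<alpha>hat n \<in> borel_measurable (data_law \<nu> f0 n)) \<longrightarrow>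
        (\<forall>n\<ge>1. AE x in data_law \<nu> f0 n. \<alpha>hat n x > 0) \<longrightarrow>
        (\<forall>n\<ge>1. AE x in data_law \<nu> f0 n. proper_posterior f \<Theta> prior n (\<alpha>hat n x) x) \<longrightarrow>
        tempering_seq \<alpha> \<longrightarrow>
        tendsto_0_in_prob (data_law \<nu> f0) (\<lambda>n x. ennreal \<bar>\<alpha>hat n x / \<alpha> n - 1\<bar>) \<longrightarrow>
        condition_1 (data_law \<nu> f0) f \<Theta> \<theta>star L c0 c1 c2 r \<gamma> \<longrightarrow>
        condition_2 (data_law \<nu> f0) f \<Theta> \<theta>hat r \<longrightarrow>
        \<kappa> > 0 \<longrightarrow> (\<forall>\<theta>\<in>\<Theta>. prior \<theta> \<le> \<kappa>) \<longrightarrow>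
        (\<forall>k::nat. tendsto_0_in_prob (data_law \<nu> f0) (\<lambda>n x.
          \<integral>\<^sup>+\<theta>. ennreal (norm (sqrt (\<alpha> n * real n) *\<^sub>R (\<theta> - \<theta>star)) ^ k *
            \<bar>posterior f \<Theta> prior n (\<alpha>hat n x) x \<theta>
              - mvn_density (\<theta>hat n x) ((1 / (\<alpha> n * real n)) *\<^sub>R matrix_inv V) \<theta>\<bar>) \<partial>lborel)))"
proof (intro conjI allI impI)
  fix \<alpha> :: "nat \<Rightarrow> real" and k :: nat
  assume \<alpha>: "tempering_seq \<alpha>"
  have pos: "\<alpha> n > 0" if "n \<ge> 1" for n using \<alpha> that by (simp add: tempering_seq_def)
  show "tendsto_0_in_prob (data_law \<nu> f0) (\<lambda>n x.
      \<integral>\<^sup>+\<theta>. ennreal (norm (sqrt (\<alpha> n * real n) *\<^sub>R (\<theta> - \<theta>star)) ^ k *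
        \<bar>posterior f \<Theta> prior n (\<alpha> n) x \<theta>
          - mvn_density (\<theta>hat n x) ((1 / (\<alpha> n * real n)) *\<^sub>R matrix_inv V) \<theta>\<bar>) \<partial>lborel)"
  proof (rule alpha_posterior_tendsto_gauss[OF model A0 A1 A2 A3 \<alpha>, where \<alpha>hat = "\<lambda>n x. \<alpha> n"])
    show "AE x in data_law \<nu> f0 n. proper_posterior f \<Theta> prior n (\<alpha> n) x" if "n \<ge> 1" for n
      using model pos[OF that] that by (simp add: parametric_model_def)
    have "\<forall>\<^sub>F n in sequentially. \<alpha> n / \<alpha> n = 1"
      using eventually_ge_at_top[of 1] by eventually_elim (use pos in fastforce)
    then show "tendsto_0_in_prob (data_law \<nu> f0) (\<lambda>n x. ennreal \<bar>\<alpha> n / \<alpha> n - 1\<bar>)"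
      unfolding tendsto_0_in_prob_def
      by (intro allI impI tendsto_eventually) (auto elim!: eventually_mono)
  qed
qed (rule alpha_posterior_tendsto_gauss[OF model A0 A1 A2 A3], auto)

end
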